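(* Let $(W,S)$ be a Coxeter system with $S$ finite. Then the generalized pure cactus group $PC_W=\ker(g_W)$ is isomorphic to a subgroup of the right-angled Coxeter group $\mathbb W$ (with generating set $\{\tau_{W'}:W'\in\mathbb S\}$) defined below.
   Context: For a Coxeter system $(W,S)$ and $I\subset S$, $W_I$ is the subgroup generated by $I$; when $W_I$ is finite, $w_I$ is its longest element. A nonempty $I\subset S$ is connected if $W_I$ is finite and there is no decomposition $I=J\cup K$ with $J,K$ disjoint nonempty and $W_I=W_J\times W_K$ (every element of $J$ commutes with every element of $K$). $\mathcal F(S)$ is the set of connected subsets. For $I\subset J$ with $W_J$ finite, $w_J(I):=\{w_Jsw_J:s\in I\}\subset S$. The generalized cactus group $C_W$ is generated by $\{\gamma_I:I\in\mathcal F(S)\}$ with relations $\gamma_I^2=1$, and $\gamma_I\gamma_J=\gamma_J\gamma_{w_J(I)}$ whenever $I\subset J$ or $W_{I\cup J}=W_I\times W_J$. The homomorphism $g_W:C_W\to W$ is $\gamma_I\mapsto w_I$, and $PC_W:=\ker g_W$. Let $\mathbb S:=\{wW_Iw^{-1}: w\in W, I\in\mathcal F(S)\}$ (a set of subgroups of $W$). For $W',W''\in\mathbb S$ put $m(W',W'')=1$ if $W'=W''$; $m(W',W'')=2$ if $W'\subsetneq W''$ or $W''\subsetneq W'$, or if $W'\cap W''=\{1\}$ and every element of $W''$ commutes with every element of $W'$; and $m(W',W'')=\infty$ otherwise. $\mathbb W$ is the Coxeter group generated by symbols $\tau_{W'}$, $W'\in\mathbb S$, with relations $\tau_{W'}^2=1$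 and $(\tau_{W'}\tau_{W''})^2=1$ whenever $m(W',W'')=2$. *)

theory Defs
  imports "HOL-Algebra.Algebra"
begin

text \<open>A letter is a generator together with a flag; (x, True) stands for x inverse.\<close>
type_synonym 'g word = "('g \<times> bool) list"

inductive pres_eq :: "'g word set \<Rightarrow> 'g word \<Rightarrow> 'g word \<Rightarrow> bool" for R where
  pres_refl: "pres_eq R w w"
| pres_sym: "pres_eq R u v \<Longrightarrow> pres_eq R v u"
| pres_trans: "pres_eq R u v \<Longrightarrow> pres_eq R v w \<Longrightarrow> pres_eq R u w"
| pres_cancel: "pres_eq R (u @ [(x, b), (x, \<not> b)] @ v) (u @ v)"
| pres_rel: "r \<in> R \<Longrightarrow> pres_eq R (u @ r @ v) (u @ v)"

definition pres_class :: "'g set \<Rightarrow> 'g word set \<Rightarrow> 'g word \<Rightarrow> 'g word set" where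
  "pres_class Gs R w = {v \<in> lists ((Sigma Gs (\<lambda>_. (UNIV :: bool set)))). pres_eq R v w}"

definition pres_group :: "'g set \<Rightarrow> 'g word set \<Rightarrow> 'g word set monoid" where
  "pres_group Gs R = \<lparr> carrier = pres_class Gs R ` lists ((Sigma Gs (\<lambda>_. (UNIV :: bool set)))),
     monoid.mult = (\<lambda>A B. {w \<in> lists ((Sigma Gs (\<lambda>_. (UNIV :: bool set)))). \<exists>a\<in>A. \<exists>b\<in>B. pres_eq R w (a @ b)}),
     one = pres_class Gs R [] \<rparr>"

definition eval_word :: "('a, 'b) monoid_scheme \<Rightarrow> ('g \<Rightarrow> 'a) \<Rightarrow> 'g word \<Rightarrow> 'a" where
  "eval_word G f w = foldr (\<lambda>(x, b) acc. (if b then inv\<^bsub>G\<^esub> (f x) else f x) \<otimes>\<^bsub>G\<^esub> acc) w \<one>\<^bsub>G\<^esub>"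

definition pres_hom :: "('a, 'b) monoid_scheme \<Rightarrow> ('g \<Rightarrow> 'a) \<Rightarrow> 'g word set \<Rightarrow> 'a" where
  "pres_hom G f A = eval_word G f (SOME w. w \<in> A)"

definition coxeter_relators :: "('a, 'b) monoid_scheme \<Rightarrow> 'a set \<Rightarrow> 'a word set" where
  "coxeter_relators W S =
     {concat (replicate (group.ord W (s \<otimes>\<^bsub>W\<^esub> t)) [(s, False), (t, False)]) | s t.
        s \<in> S \<and> t \<in> S \<and> group.ord W (s \<otimes>\<^bsub>W\<^esub> t) \<noteq> 0}"

text \<open>(W,S) is a Coxeter system: S is a set of involutions of W and the canonical map
  from the group presented by generators S and relations (st)^(m(s,t)) = 1
  (m(s,t) the order of st, relation omitted when infinite) to W is an isomorphism.\<close>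
definition coxeter_system :: "('a, 'b) monoid_scheme \<Rightarrow> 'a set \<Rightarrow> bool" where
  "coxeter_system W S \<longleftrightarrow> group W \<and> S \<subseteq> carrier W \<and>
     (\<forall>s\<in>S. s \<noteq> \<one>\<^bsub>W\<^esub> \<and> s \<otimes>\<^bsub>W\<^esub> s = \<one>\<^bsub>W\<^esub>) \<and>
     pres_hom W id \<in> iso (pres_group S (coxeter_relators W S)) W"

definition cox_length :: "('a, 'b) monoid_scheme \<Rightarrow> 'a set \<Rightarrow> 'a \<Rightarrow> nat" where
  "cox_length W S w = (LEAST n. \<exists>l. set l \<subseteq> S \<and> length l = n \<and> foldr (\<otimes>\<^bsub>W\<^esub>) l \<one>\<^bsub>W\<^esub> = w)"

abbreviation parabolic :: "('a, 'b) monoid_scheme \<Rightarrow> 'a set \<Rightarrow> 'a set" where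
  "parabolic W I \<equiv> generate W I"

definition longest :: "('a, 'b) monoid_scheme \<Rightarrow> 'a set \<Rightarrow> 'a set \<Rightarrow> 'a" where
  "longest W S I = (THE w. w \<in> generate W I \<and>
      (\<forall>v \<in> generate W I. v \<noteq> w \<longrightarrow> cox_length W S v < cox_length W S w))"

text \<open>Internal direct product: W_{I \<union> J} = W_I \<times> W_J.\<close>
definition is_dprod :: "('a, 'b) monoid_scheme \<Rightarrow> 'a set \<Rightarrow> 'a set \<Rightarrow> bool" where
  "is_dprod W I J \<longleftrightarrow>
     (\<forall>x \<in> generate W I. \<forall>y \<in> generate W J. x \<otimes>\<^bsub>W\<^esub> y = y \<otimes>\<^bsub>W\<^esub> x) \<and>
     generate W I \<inter> generate W J = {\<one>\<^bsub>W\<^esub>}"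

definition connected_subset :: "('a, 'b) monoid_scheme \<Rightarrow> 'a set \<Rightarrow> 'a set \<Rightarrow> bool" where
  "connected_subset W S I \<longleftrightarrow> I \<noteq> {} \<and> I \<subseteq> S \<and> finite (generate W I) \<and>
     \<not> (\<exists>J K. J \<noteq> {} \<and> K \<noteq> {} \<and> J \<inter> K = {} \<and> I = J \<union> K \<and> is_dprod W J K)"

definition conn_subsets :: "('a, 'b) monoid_scheme \<Rightarrow> 'a set \<Rightarrow> 'a set set" where
  "conn_subsets W S = {I. connected_subset W S I}"

definition conj_longest :: "('a, 'b) monoid_scheme \<Rightarrow> 'a set \<Rightarrow> 'a set \<Rightarrow> 'a set \<Rightarrow> 'a set" where
  "conj_longest W S J I = (\<lambda>s. longest W S J \<otimes>\<^bsub>W\<^esub> s \<otimes>\<^bsub>W\<^esub> longest W S J) ` I"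

definition cactus_relators :: "('a, 'b) monoid_scheme \<Rightarrow> 'a set \<Rightarrow> 'a set word set" where
  "cactus_relators W S =
     {[(I, False), (I, False)] | I. I \<in> conn_subsets W S} \<union>
     {[(I, False), (J, False), (conj_longest W S J I, True), (J, True)] | I J.
        I \<in> conn_subsets W S \<and> J \<in> conn_subsets W S \<and> (I \<subseteq> J \<or> is_dprod W I J)}"

definition cactus_group :: "('a, 'b) monoid_scheme \<Rightarrow> 'a set \<Rightarrow> 'a set word set monoid" where
  "cactus_group W S = pres_group (conn_subsets W S) (cactus_relators W S)"

definition cactus_hom :: "('a, 'b) monoid_scheme \<Rightarrow> 'a set \<Rightarrow> 'a set word set \<Rightarrow> 'a" where
  "cactus_hom W S = pres_hom W (longest W S)"

definition pure_cactus_group :: "('a, 'b) monoid_scheme \<Rightarrow> 'a set \<Rightarrow> 'a set word set monoid" where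
  "pure_cactus_group W S = (cactus_group W S)\<lparr> carrier :=
     {x \<in> carrier (cactus_group W S). cactus_hom W S x = \<one>\<^bsub>W\<^esub>} \<rparr>"

definition conj_parabolics :: "('a, 'b) monoid_scheme \<Rightarrow> 'a set \<Rightarrow> 'a set set" where
  "conj_parabolics W S = {(\<lambda>x. w \<otimes>\<^bsub>W\<^esub> x \<otimes>\<^bsub>W\<^esub> inv\<^bsub>W\<^esub> w) ` generate W I | w I.
      w \<in> carrier W \<and> I \<in> conn_subsets W S}"

definition m_two :: "('a, 'b) monoid_scheme \<Rightarrow> 'a set \<Rightarrow> 'a set \<Rightarrow> bool" where
  "m_two W W1 W2 \<longleftrightarrow> W1 \<subset> W2 \<or> W2 \<subset> W1 \<or>
     (W1 \<inter> W2 = {\<one>\<^bsub>W\<^esub>} \<and> (\<forall>x\<in>W1. \<forall>y\<in>W2. x \<otimes>\<^bsub>W\<^esub> y = y \<otimes>\<^bsub>W\<^esub> x))"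

definition RACG_relators :: "('a, 'b) monoid_scheme \<Rightarrow> 'a set \<Rightarrow> 'a set word set" where
  "RACG_relators W S =
     {[(Gs, False), (Gs, False)] | Gs. Gs \<in> conj_parabolics W S} \<union>
     {[(Gs, False), (Y, False), (Gs, False), (Y, False)] | Gs Y.
        Gs \<in> conj_parabolics W S \<and> Y \<in> conj_parabolics W S \<and> m_two W Gs Y}"

definition RACG :: "('a, 'b) monoid_scheme \<Rightarrow> 'a set \<Rightarrow> 'a set word set monoid" where
  "RACG W S = pres_group (conj_parabolics W S) (RACG_relators W S)"

end

theory Submission
  imports Defs
begin

text \<open>
  Let \<open>R\<close> be the right-angled Coxeter group and let \<open>C\<^sub>W\<close> map to the semidirect product of \<open>R\<close>
  and \<open>W\<close>, where \<open>W\<close> acts on \<open>R\<close> by permuting the generators, via \<open>\<gamma>\<^sub>I \<mapsto> (\<tau>\<^bsub>W\<^sub>I\<^esub>, w\<^sub>I)\<close>. On \<open>PC\<^sub>W\<close> the second component vanishes, so it suffices that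
  this map is injective. The first component of the image of \<open>\<gamma>\<^bsub>I\<^sub>1\<^esub> \<dots> \<gamma>\<^bsub>I\<^sub>n\<^esub>\<close> is a word of length \<open>n\<close> in the
  generators of \<open>R\<close>. If it is trivial and \<open>n > 0\<close>, the solution of the word problem in a right-angled
  Coxeter group provides two equal letters such that the first commutes with all letters between.
  Every commutation of neighbouring letters in \<open>R\<close> lifts to a defining relation
  \<open>\<gamma>\<^sub>I \<gamma>\<^sub>J = \<gamma>\<^sub>J \<gamma>\<^bsub>w\<^sub>J(I)\<^esub>\<close> (read in one of the two directions), so the two corresponding letters of the
  cactus word can be made adjacent; they are then equal and cancel, and one concludes by induction on \<open>n\<close>.
\<close>

section \<open>Group presentations\<close>

abbreviation words :: "'g set \<Rightarrow> 'g word set" where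
  "words Gs \<equiv> lists (Sigma Gs (\<lambda>_. (UNIV :: bool set)))"

text \<open>Both presented groups are generated by involutions, so words without inverse letters
  suffice; for the cactus group \<open>pres_eq_letters\<close> makes this precise.\<close>

definition letters :: "'g list \<Rightarrow> 'g word" where
  "letters l = map (\<lambda>x. (x, False)) l"

lemma letters_append: "letters (l @ l') = letters l @ letters l'"
  by (simp add: letters_def)

lemma letters_words: "set l \<subseteq> Gs \<Longrightarrow> letters l \<in> words Gs"
  by (auto simp: letters_def)

lemma map_fst_letters [simp]: "map fst (letters l) = l"
  by (simp add: letters_def comp_def)

lemma words_subset: "w \<in> words Gs \<Longrightarrow> set (map fst w) \<subseteq> Gs"
  by auto

definition inv_word :: "'g word \<Rightarrow> 'g word" where
  "inv_word w = rev (map (\<lambda>(x, b). (x, \<not> b)) w)"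

lemma inv_word_in_words: "w \<in> words Gs \<Longrightarrow> inv_word w \<in> words Gs"
  by (auto simp: inv_word_def)

lemma pres_eq_context: "pres_eq R u v \<Longrightarrow> pres_eq R (x @ u @ y) (x @ v @ y)"
proof (induction rule: pres_eq.induct)
  case (pres_cancel u z b v)
  show ?case using pres_eq.pres_cancel[of R "x @ u" z b "v @ y"] by simp
next
  case (pres_rel r u v)
  then show ?case using pres_eq.pres_rel[of r R "x @ u" "v @ y"] by simp
qed (auto intro: pres_eq.intros)

lemma pres_eq_append:
  assumes "pres_eq R u u'" "pres_eq R v v'"
  shows "pres_eq R (u @ v) (u' @ v')"
  using pres_eq_context[OF assms(1), of "[]" v] pres_eq_context[OF assms(2), of u' "[]"]
  by (auto intro: pres_trans)

lemma pres_eq_inv_word: "pres_eq R (w @ inv_word w) []"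
proof (induction w)
  case (Cons a w)
  obtain x b where a: "a = (x, b)" by force
  have "pres_eq R ([a] @ (w @ inv_word w) @ [(x, \<not> b)]) ([a] @ [] @ [(x, \<not> b)])"
    by (rule pres_eq_context) (rule Cons.IH)
  moreover have "pres_eq R [(x, b), (x, \<not> b)] []"
    using pres_cancel[of R "[]" x b "[]"] by simp
  ultimately show ?case by (auto simp: inv_word_def a intro: pres_trans)
qed (simp add: inv_word_def pres_refl)

lemma pres_eq_cancel_right:
  assumes "pres_eq R (u @ inv_word v) []"
  shows "pres_eq R u v"
proof -
  have inv_inv: "inv_word (inv_word v) = v"
    by (induction v) (auto simp: inv_word_def)
  have "pres_eq R (inv_word v @ v) []"
    using pres_eq_inv_word[of R "inv_word v"] by (simp add: inv_inv)
  then have "pres_eq R u (u @ inv_word v @ v)"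
    using pres_eq_append[OF pres_refl[of R u], of "inv_word v @ v" "[]"] by (auto intro: pres_sym)
  moreover have "pres_eq R ((u @ inv_word v) @ v) ([] @ v)"
    using assms pres_refl by (rule pres_eq_append)
  ultimately show ?thesis by (auto intro: pres_trans)
qed

text \<open>\<^const>\<open>pres_eq\<close> may pass through words with letters outside \<open>Gs\<close>;
  deleting these letters turns such a chain into one inside \<open>words Gs\<close>.\<close>

lemma pres_eq_invariant:
  fixes F :: "'g word \<Rightarrow> 'x"
  assumes eq: "pres_eq R u v" and R: "R \<subseteq> words Gs"
    and u: "u \<in> words Gs" and v: "v \<in> words Gs"
    and cancel: "\<And>u v x b. u \<in> words Gs \<Longrightarrow> v \<in> words Gs \<Longrightarrow> x \<in> Gs \<Longrightarrow>
                   F (u @ [(x, b), (x, \<not> b)] @ v) = F (u @ v)"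
    and rel: "\<And>u v r. u \<in> words Gs \<Longrightarrow> v \<in> words Gs \<Longrightarrow> r \<in> R \<Longrightarrow> F (u @ r @ v) = F (u @ v)"
  shows "F u = F v"
proof -
  define f where "f = (filter (\<lambda>a. fst a \<in> Gs) :: 'g word \<Rightarrow> 'g word)"
  have f_words: "f w \<in> words Gs" for w
    by (auto simp: f_def)
  have f_id: "f w = w" if "w \<in> words Gs" for w
    using that by (force simp: f_def filter_id_conv)
  have f_append: "f (a @ b) = f a @ f b" for a b
    by (simp add: f_def)
  have "F (f u) = F (f v)"
    using eq
  proof (induction rule: pres_eq.induct)
    case (pres_cancel u x b v)
    show ?case
    proof (cases "x \<in> Gs")
      case True
      then have "f [(x, b), (x, \<not> b)] = [(x, b), (x, \<not> b)]" by (simp add: f_def)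
      then show ?thesis using cancel[OF f_words f_words True] by (simp only: f_append)
    next
      case False
      then show ?thesis by (simp add: f_def)
    qed
  next
    case (pres_rel r u v)
    then have "f r = r" using R f_id by blast
    then show ?case using rel[OF f_words f_words pres_rel] by (simp add: f_append)
  qed simp_all
  then show ?thesis using f_id u v by simp
qed

lemma pres_class_eq_iff:
  assumes "u \<in> words Gs" "v \<in> words Gs"
  shows "pres_class Gs R u = pres_class Gs R v \<longleftrightarrow> pres_eq R u v"
proof
  assume "pres_class Gs R u = pres_class Gs R v"
  moreover have "u \<in> pres_class Gs R u" using assms by (simp add: pres_class_def pres_refl)
  ultimately show "pres_eq R u v" by (simp add: pres_class_def)
next
  assume uv: "pres_eq R u v"
  have "pres_eq R w u \<longleftrightarrow> pres_eq R w v" for w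
    using uv pres_sym[OF uv] pres_trans by blast
  then show "pres_class Gs R u = pres_class Gs R v" by (simp add: pres_class_def)
qed

text \<open>\<open>pres_hom\<close> and the final embedding evaluate a class at a representative
  picked by \<open>SOME\<close>; these are the two facts about that choice that get used.\<close>

lemma some_in_pres_class:
  assumes "u \<in> words Gs" "A = pres_class Gs R u"
  shows "(SOME w. w \<in> A) \<in> words Gs" "pres_eq R (SOME w. w \<in> A) u"
proof -
  have "u \<in> A" using assms by (simp add: pres_class_def pres_refl)
  then have "(SOME w. w \<in> A) \<in> A" by (rule someI)
  then show "(SOME w. w \<in> A) \<in> words Gs" "pres_eq R (SOME w. w \<in> A) u"
    by (auto simp: assms(2) pres_class_def)
qed

lemma mult_pres_class:
  assumes "u \<in> words Gs" "v \<in> words Gs"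
  shows "pres_class Gs R u \<otimes>\<^bsub>pres_group Gs R\<^esub> pres_class Gs R v = pres_class Gs R (u @ v)"
proof -
  have "(\<exists>a\<in>pres_class Gs R u. \<exists>b\<in>pres_class Gs R v. pres_eq R w (a @ b)) \<longleftrightarrow> pres_eq R w (u @ v)" for w
  proof
    assume "\<exists>a\<in>pres_class Gs R u. \<exists>b\<in>pres_class Gs R v. pres_eq R w (a @ b)"
    then obtain a b where "pres_eq R a u" "pres_eq R b v" "pres_eq R w (a @ b)"
      by (auto simp: pres_class_def)
    then show "pres_eq R w (u @ v)" using pres_eq_append pres_trans by metis
  next
    assume "pres_eq R w (u @ v)"
    then show "\<exists>a\<in>pres_class Gs R u. \<exists>b\<in>pres_class Gs R v. pres_eq R w (a @ b)"
      using assms by (intro bexI[of _ u] bexI[of _ v]) (auto simp: pres_class_def pres_refl)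
  qed
  then show ?thesis by (simp add: pres_group_def pres_class_def)
qed

lemma carrier_pres_group: "carrier (pres_group Gs R) = pres_class Gs R ` words Gs"
  by (simp add: pres_group_def)

section \<open>The word problem in right-angled Coxeter groups\<close>

locale commutation =
  fixes comm :: "'g \<Rightarrow> 'g \<Rightarrow> bool"
  assumes comm_sym: "comm a b \<Longrightarrow> comm b a"
    and comm_irrefl: "\<not> comm a a"
begin

text \<open>This is equality in the partially commutative (Cartier-Foata) monoid: letters are
  reordered but never cancelled, so only \<open>[]\<close> is equivalent to
  \<open>[]\<close>.\<close>

inductive trace_eq :: "'g list \<Rightarrow> 'g list \<Rightarrow> bool" (infix \<open>\<doteq>\<close> 50) where
  trace_refl: "w \<doteq> w"
| trace_trans: "u \<doteq> v \<Longrightarrow> v \<doteq> w \<Longrightarrow> u \<doteq> w"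
| trace_swap: "comm a b \<Longrightarrow> a # b # w \<doteq> b # a # w"
| trace_Cons: "u \<doteq> v \<Longrightarrow> a # u \<doteq> a # v"

lemma trace_sym: "u \<doteq> v \<Longrightarrow> v \<doteq> u"
  by (induction rule: trace_eq.induct) (auto intro: trace_eq.intros comm_sym)

lemma trace_eq_length: "u \<doteq> v \<Longrightarrow> length u = length v"
  by (induction rule: trace_eq.induct) auto

text \<open>The search carries the leftmost \<open>a\<close> to the front past letters commuting
  with it. \<open>None\<close> means that this \<open>a\<close> is absent or blocked, so left
  multiplication by \<open>a\<close> cancels nothing.\<close>

fun pull :: "'g \<Rightarrow> 'g list \<Rightarrow> 'g list option" where
  "pull a [] = None"
| "pull a (b # w) = (if a = b then Some w
     else if comm a b then map_option ((#) b) (pull a w) else None)"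

text \<open>On trace classes of reduced words this is left multiplication by the involution
  \<open>a\<close>. Folding it over a word computes a normal form, unique up to trace
  equivalence.\<close>

definition push :: "'g \<Rightarrow> 'g list \<Rightarrow> 'g list" where
  "push a w = (case pull a w of None \<Rightarrow> a # w | Some w' \<Rightarrow> w')"

fun reduced :: "'g list \<Rightarrow> bool" where
  "reduced [] = True"
| "reduced (a # w) = (pull a w = None \<and> reduced w)"

lemma pull_trace: "pull a w = Some w' \<Longrightarrow> w \<doteq> a # w'"
proof (induction w arbitrary: w')
  case (Cons b w)
  show ?case
  proof (cases "a = b")
    case True
    then show ?thesis using Cons by (auto intro: trace_refl)
  next
    case False
    then obtain z where z: "comm a b" "pull a w = Some z" "w' = b # z"
      using Cons.prems by (auto split: if_splits)
    have "b # w \<doteq> b # a # z" by (intro trace_Cons Cons.IH z)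
    then show ?thesis using z by (auto intro: trace_eq.intros comm_sym)
  qed
qed simp

text \<open>This makes \<open>pull\<close> well defined on traces. In the swap case the letter
  sought is either one of the two swapped letters or has to pass both of them in either
  order.\<close>

lemma pull_cong: "u \<doteq> v \<Longrightarrow> rel_option (\<doteq>) (pull a u) (pull a v)"
proof (induction arbitrary: a rule: trace_eq.induct)
  case (trace_refl w)
  then show ?case by (intro option.rel_refl trace_eq.trace_refl)
next
  case (trace_trans u v w)
  show ?case using trace_trans.IH[of a]
    by (cases "pull a u"; cases "pull a v"; cases "pull a w") (auto intro: trace_eq.trace_trans)
next
  case (trace_swap a b w c)
  then show ?case using comm_irrefl comm_sym
    by (cases "pull c w") (auto intro: trace_eq.intros)
next
  case (trace_Cons u v a)
  then show ?case
    by (auto intro: trace_eq.trace_Cons option.rel_mono_strong simp: option.rel_map)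
qed

lemma pull_eq_None_cong: "u \<doteq> v \<Longrightarrow> pull a u = None \<longleftrightarrow> pull a v = None"
  using pull_cong[of u v a] 
  by (cases "pull a u"; cases "pull a v") auto

lemma push_cong: "u \<doteq> v \<Longrightarrow> push a u \<doteq> push a v"
  using pull_cong[of u v a]
  by (cases "pull a u"; cases "pull a v") (auto simp: push_def intro: trace_Cons)

lemma reduced_cong: "u \<doteq> v \<Longrightarrow> reduced u = reduced v"
proof (induction rule: trace_eq.induct)
  case (trace_swap a b w)
  then show ?case using comm_irrefl comm_sym by auto
qed (auto simp: pull_eq_None_cong)

lemma reduced_push: "reduced w \<Longrightarrow> reduced (push a w)"
  using reduced_cong[OF pull_trace, of a w] by (cases "pull a w") (auto simp: push_def)

text \<open>If the first push removes an \<open>a\<close>, reducedness leaves no second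
  \<open>a\<close> within reach, so the second push puts the letter back.\<close>

lemma push_push_same:
  assumes "reduced w"
  shows "push a (push a w) \<doteq> w"
proof (cases "pull a w")
  case None
  then show ?thesis by (simp add: push_def trace_refl)
next
  case (Some w')
  then have w: "w \<doteq> a # w'" by (rule pull_trace)
  then have "pull a w' = None" using reduced_cong assms by auto
  then show ?thesis using w Some by (simp add: push_def trace_sym)
qed

text \<open>Together with \<open>push_push_same\<close> this lets the right-angled Coxeter group act
  on trace classes of reduced words. The cases depend on which of the two letters can be
  pulled.\<close>

lemma push_commute:
  assumes ab: "comm a b"
  shows "push a (push b w) \<doteq> push b (push a w)"
proof -
  have ne: "a \<noteq> b" and ba: "comm b a" using ab comm_irrefl comm_sym by auto
  \<comment> \<open>The mixed case, where only one letter can be pulled, is stated for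
    \<open>c\<close> and \<open>d\<close> so that it serves both orders.\<close>
  have one: "push c (push d w) \<doteq> push d (push c w)"
    if "comm c d" "pull c w = Some w'" "pull d w = None" for c d w'
  proof -
    have ne: "c \<noteq> d" and dc: "comm d c" using that comm_irrefl comm_sym by auto
    have "pull d (c # w') = None"
      using pull_eq_None_cong[OF pull_trace[OF that(2)], of d] that(3) by blast
    then have "pull d w' = None" using ne dc by auto
    then show ?thesis using that ne by (simp add: push_def trace_refl)
  qed
  show ?thesis
  proof (cases "pull a w")
    case None
    show ?thesis
    proof (cases "pull b w")
      assume "pull b w = None"
      then show ?thesis using None ne ab ba by (simp add: push_def trace_swap)
    next
      fix w' assume "pull b w = Some w'"
      then show ?thesis using one[OF ba _ None] trace_sym by blast
    qed
  next
    case a: (Some w')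
    show ?thesis
    proof (cases "pull b w")
      assume "pull b w = None"
      then show ?thesis using one[OF ab a] by blast
    next
      fix w'' assume b: "pull b w = Some w''"
      \<comment> \<open>When both letters can be pulled, taking \<open>b\<close> out of
        \<open>a # w'\<close> yields a word \<open>z\<close> that has lost both, and
        \<open>w''\<close> is \<open>a # z\<close> up to trace equivalence.\<close>
      have "rel_option (\<doteq>) (Some w'') (pull b (a # w'))"
        using pull_cong[OF pull_trace[OF a], of b] b by simp
      then obtain z where z: "pull b w' = Some z" "w'' \<doteq> a # z"
        using ne ba by (auto simp: option_rel_Some1)
      have "push a w'' \<doteq> push a (a # z)" using z(2) by (rule push_cong)
      then show ?thesis using a b z by (simp add: push_def)
    qed
  qed
qed

lemma foldr_push_cong: "u \<doteq> v \<Longrightarrow> foldr push w u \<doteq> foldr push w v"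
  by (induction w) (auto intro: push_cong)

lemma reduced_foldr_push: "reduced v \<Longrightarrow> reduced (foldr push w v)"
  by (induction w) (auto intro: reduced_push)

lemma foldr_push_reduced: "reduced w \<Longrightarrow> foldr push w [] = w"
  by (induction w) (auto simp: push_def)

text \<open>The normal form does not see inserted relators. The case \<open>a = b\<close> of the
  longer relator is allowed because \<open>m_two\<close> does not by itself assert that its
  arguments differ; it reduces to squares.\<close>

lemma foldr_push_relator:
  assumes "x = [a, a] \<or> x = [a, b, a, b] \<and> (comm a b \<or> a = b)"
  shows "foldr push (u @ x @ v) [] \<doteq> foldr push (u @ v) []"
proof -
  have red: "reduced (foldr push v [])"
    by (rule reduced_foldr_push) simp
  have "foldr push x z \<doteq> z" if "reduced z" for z
    using assms
  proof
    assume x: "x = [a, b, a, b] \<and> (comm a b \<or> a = b)"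
    have "push a (push b (push a (push b z))) \<doteq> z"
    proof (cases "a = b")
      case True
      then show ?thesis
        using trace_trans[OF push_push_same[of "push a (push a z)" a] push_push_same[OF that]]
        by (simp add: reduced_push that)
    next
      case False
      then have "push b (push a (push b z)) \<doteq> push b (push b (push a z))"
        using x push_cong push_commute by blast
      also have "trace_eq \<dots> (push a z)"
        using that by (intro push_push_same reduced_push)
      finally (trace_trans) have "push a (push b (push a (push b z))) \<doteq> push a (push a z)"
        by (rule push_cong)
      then show ?thesis using push_push_same[OF that, of a] by (rule trace_trans)
    qed
    then show ?thesis using x by simp
  qed (simp add: push_push_same that)
  then have "foldr push x (foldr push v []) \<doteq> foldr push v []" using red .
  then show ?thesis by (simp add: foldr_push_cong)
qed

text \<open>A reduced word is its own normal form, so a nonempty word with empty normal form is not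
  reduced and some letter reaches a later copy of itself.\<close>

lemma foldr_push_Nil_imp_pull:
  assumes "foldr push w [] = []" "w \<noteq> []"
  obtains x a y y' where "w = x @ a # y" "pull a y = Some y'"
proof -
  have "\<not> reduced w" using assms foldr_push_reduced by force
  then have "\<exists>x a y y'. w = x @ a # y \<and> pull a y = Some y'"
  proof (induction w)
    case (Cons b w)
    show ?case
    proof (cases "pull b w")
      case None
      then obtain x a y y' where "w = x @ a # y" "pull a y = Some y'"
        using Cons by auto
      then have "b # w = (b # x) @ a # y" by simp
      then show ?thesis using \<open>pull a y = Some y'\<close> by blast
    next
      case (Some y')
      then show ?thesis by (intro exI[of _ "[]"]) auto
    qed
  qed simp
  then show ?thesis using that by blast
qed

end

section \<open>Length and longest elements in Coxeter groups\<close>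

locale coxeter = group W for W :: "('a, 'b) monoid_scheme" (structure) +
  fixes S :: "'a set"
  assumes cox: "coxeter_system W S"
begin

abbreviation prodl :: "'a list \<Rightarrow> 'a" where
  "prodl l \<equiv> foldr (\<otimes>) l \<one>"

abbreviation len :: "'a \<Rightarrow> nat" where
  "len \<equiv> cox_length W S"

definition conjug :: "'a \<Rightarrow> 'a \<Rightarrow> 'a" where
  "conjug u x = u \<otimes> x \<otimes> inv u"

lemma S_carrier: "S \<subseteq> carrier W"
  and S_not_one: "s \<in> S \<Longrightarrow> s \<noteq> \<one>"
  and S_square: "s \<in> S \<Longrightarrow> s \<otimes> s = \<one>"
  and presentation: "pres_hom W id \<in> iso (pres_group S (coxeter_relators W S)) W"
  using cox by (auto simp: coxeter_system_def)

lemma S_closed [simp]: "s \<in> S \<Longrightarrow> s \<in> carrier W"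
  using S_carrier by auto

lemma S_inv [simp]: "s \<in> S \<Longrightarrow> inv s = s"
  using S_square by (simp add: inv_equality)

lemma conjug_closed [simp]: "u \<in> carrier W \<Longrightarrow> x \<in> carrier W \<Longrightarrow> conjug u x \<in> carrier W"
  by (simp add: conjug_def)

lemma conjug_mult:
  "u \<in> carrier W \<Longrightarrow> v \<in> carrier W \<Longrightarrow> x \<in> carrier W \<Longrightarrow> conjug (u \<otimes> v) x = conjug u (conjug v x)"
  by (simp add: conjug_def inv_mult_group m_assoc)

lemma conjug_one [simp]: "x \<in> carrier W \<Longrightarrow> conjug \<one> x = x"
  by (simp add: conjug_def)

lemma conjug_inv [simp]:
  assumes "u \<in> carrier W" "x \<in> carrier W"
  shows "conjug (inv u) (conjug u x) = x" "conjug u (conjug (inv u) x) = x"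
  using assms by (simp_all flip: conjug_mult)

lemma conjug_inj: "u \<in> carrier W \<Longrightarrow> inj_on (conjug u) (carrier W)"
  by (metis conjug_inv(1) inj_onI)

lemma conjug_eq_iff:
  "u \<in> carrier W \<Longrightarrow> x \<in> carrier W \<Longrightarrow> y \<in> carrier W \<Longrightarrow> conjug u x = conjug u y \<longleftrightarrow> x = y"
  by (rule inj_on_eq_iff[OF conjug_inj])

lemma conjug_hom: "u \<in> carrier W \<Longrightarrow> group_hom W W (conjug u)"
proof -
  assume u: "u \<in> carrier W"
  have "conjug u (x \<otimes> y) = conjug u x \<otimes> conjug u y" if "x \<in> carrier W" "y \<in> carrier W" for x y
  proof -
    have "inv u \<otimes> (u \<otimes> (y \<otimes> inv u)) = y \<otimes> inv u"
      using that u by (simp flip: m_assoc)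
    then show ?thesis using that u by (simp add: conjug_def m_assoc)
  qed
  then show ?thesis using u
    by (intro group_hom.intro group_hom_axioms.intro is_group homI) auto
qed

section \<open>Products of words and parities of their reflections\<close>

lemma prodl_closed [simp]: "set l \<subseteq> carrier W \<Longrightarrow> prodl l \<in> carrier W"
  by (induction l) auto

lemma prodl_append:
  "set l \<subseteq> carrier W \<Longrightarrow> set l' \<subseteq> carrier W \<Longrightarrow> prodl (l @ l') = prodl l \<otimes> prodl l'"
  by (induction l) (auto simp: m_assoc simp del: foldr_append)

text \<open>For \<open>l = s\<^sub>1 \<dots> s\<^sub>q\<close> these are the reflections
  \<open>s\<^sub>1 \<dots> s\<^sub>i \<dots> s\<^sub>1\<close>. The parity of the multiplicity of each element
  depends only on the product of \<open>l\<close>, because it is even for the Coxeter relators.\<close>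

fun refls :: "'a list \<Rightarrow> 'a list" where
  "refls [] = []"
| "refls (s # l) = s # map (conjug s) (refls l)"

definition par :: "'a list \<Rightarrow> 'a \<Rightarrow> bool" where
  "par l t = odd (count_list (refls l) t)"

lemma length_refls [simp]: "length (refls l) = length l"
  by (induction l) auto

lemma refls_closed: "set l \<subseteq> carrier W \<Longrightarrow> set (refls l) \<subseteq> carrier W"
  by (induction l) auto

lemma refls_append:
  "set l \<subseteq> carrier W \<Longrightarrow> set l' \<subseteq> carrier W \<Longrightarrow>
    refls (l @ l') = refls l @ map (conjug (prodl l)) (refls l')"
proof (induction l)
  case Nil
  then show ?case using refls_closed[of l'] by (auto simp: map_idI subset_iff)
next
  case (Cons s l)
  have "set (refls l') \<subseteq> carrier W" using Cons refls_closed by simp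
  then show ?case using Cons by (auto simp: conjug_mult subset_iff)
qed

lemma count_map_conj:
  assumes "u \<in> carrier W" "set L \<subseteq> carrier W" "t \<in> carrier W"
  shows "count_list (map (conjug u) L) t = count_list L (conjug (inv u) t)"
  using assms
proof (induction L)
  case (Cons a L)
  then have "conjug u a = t \<longleftrightarrow> a = conjug (inv u) t" by auto
  then show ?case using Cons by auto
qed simp

text \<open>The cocycle identity: appending \<open>l'\<close> contributes its reflections conjugated
  by the product of \<open>l\<close>. \<open>inversions_mult\<close> is the version for group
  elements.\<close>

lemma par_append:
  assumes "set l \<subseteq> carrier W" "set l' \<subseteq> carrier W" "t \<in> carrier W"
  shows "par (l @ l') t \<longleftrightarrow> par l t \<noteq> par l' (conjug (inv (prodl l)) t)"
  using assms by (simp add: par_def refls_append count_map_conj refls_closed)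

fun alternating :: "'a \<Rightarrow> 'a \<Rightarrow> nat \<Rightarrow> 'a list" where
  "alternating s t 0 = []"
| "alternating s t (Suc n) = s # alternating t s n"

lemma concat_replicate_alternating: "concat (replicate k [s, t]) = alternating s t (2 * k)"
  by (induction k) auto

lemma prodl_alternating:
  "s \<in> carrier W \<Longrightarrow> t \<in> carrier W \<Longrightarrow> prodl (alternating s t (2 * k)) = (s \<otimes> t) [^] k"
proof (induction k)
  case (Suc k)
  have "(s \<otimes> t) [^] Suc k = (s \<otimes> t) \<otimes> (s \<otimes> t) [^] k"
    using Suc.prems by (intro nat_pow_Suc2) simp
  then show ?case using Suc by (simp add: m_assoc del: nat_pow_Suc)
qed simp

lemma pow_shift:
  assumes "s \<in> carrier W" "t \<in> carrier W"
  shows "s \<otimes> (t \<otimes> s) [^] (j :: nat) = (s \<otimes> t) [^] j \<otimes> s"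
proof (induction j)
  case (Suc j)
  have "s \<otimes> (t \<otimes> s) [^] Suc j = (s \<otimes> (t \<otimes> s) [^] j) \<otimes> (t \<otimes> s)"
    using assms by (simp add: m_assoc)
  then show ?case using assms Suc by (simp add: m_assoc)
qed (use assms in simp)

lemma refls_alternating:
  "s \<in> S \<Longrightarrow> t \<in> S \<Longrightarrow> refls (alternating s t n) = map (\<lambda>j. (s \<otimes> t) [^] j \<otimes> s) [0..<n]"
proof (induction n arbitrary: s t)
  case (Suc n)
  have "conjug s ((t \<otimes> s) [^] j \<otimes> t) = (s \<otimes> t) [^] Suc j \<otimes> s" for j :: nat
  proof -
    have "conjug s ((t \<otimes> s) [^] j \<otimes> t) = (s \<otimes> (t \<otimes> s) [^] j) \<otimes> t \<otimes> s"
      using Suc.prems by (simp add: conjug_def m_assoc)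
    also have "\<dots> = (s \<otimes> t) [^] Suc j \<otimes> s"
      using Suc.prems by (simp only: pow_shift S_closed) (simp add: m_assoc)
    finally show ?thesis .
  qed
  moreover have "[0..<Suc n] = 0 # map Suc [0..<n]"
    by (simp add: upt_conv_Cons map_Suc_upt del: upt_Suc)
  ultimately show ?case using Suc by (simp add: comp_def del: upt_Suc nat_pow_Suc)
qed simp

text \<open>The reflections of the relator are \<open>(s \<otimes> t) [^] j \<otimes> s\<close> for
  \<open>j < 2 * m\<close>. They repeat with period \<open>m\<close>, so each value occurs an even
  number of times.\<close>

lemma par_relator:
  assumes "s \<in> S" "t \<in> S" "(s \<otimes> t) [^] (m :: nat) = \<one>"
  shows "\<not> par (concat (replicate m [s, t])) x"
proof -
  let ?f = "\<lambda>j. (s \<otimes> t) [^] j \<otimes> s"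
  have "[0..<2 * m] = [0..<m] @ map (\<lambda>j. j + m) [0..<m]"
    using upt_add_eq_append[of 0 m m] by (simp add: map_add_upt mult_2)
  moreover have "?f (j + m) = ?f j" for j
    using assms by (simp flip: nat_pow_mult)
  ultimately show ?thesis
    using assms(1,2)
    by (simp add: concat_replicate_alternating par_def refls_alternating comp_def)
qed

lemma eval_word_id: "w \<in> words S \<Longrightarrow> eval_word W id w = prodl (map fst w)"
  by (induction w) (auto simp: eval_word_def)

lemma relatorE:
  assumes "r \<in> coxeter_relators W S"
  obtains s t m where "s \<in> S" "t \<in> S" "(s \<otimes> t) [^] (m :: nat) = \<one>"
    "map fst r = concat (replicate m [s, t])" "r \<in> words S"
proof -
  obtain s t where st: "s \<in> S" "t \<in> S"
    "r = concat (replicate (ord (s \<otimes> t)) [(s, False), (t, False)])"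
    using assms by (auto simp: coxeter_relators_def)
  have "(s \<otimes> t) [^] ord (s \<otimes> t) = \<one>" using st by (simp add: pow_ord_eq_1)
  moreover have "map fst r = concat (replicate (ord (s \<otimes> t)) [s, t])"
    by (simp add: st(3) map_concat)
  moreover have "r \<in> words S" using st by (auto split: if_splits)
  ultimately show ?thesis using that st by blast
qed

lemma coxeter_relators_words: "coxeter_relators W S \<subseteq> words S"
  using relatorE by blast

text \<open>Inserting a relator changes no parity: its own parities vanish, and since its product is
  trivial the suffix is still read at the same conjugate.\<close>

lemma pres_eq_prodl_par:
  assumes "pres_eq (coxeter_relators W S) u v" "u \<in> words S" "v \<in> words S"
  shows "prodl (map fst u) = prodl (map fst v) \<and>
    (\<forall>t \<in> carrier W. par (map fst u) t = par (map fst v) t)"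
proof -
  \<comment> \<open>\<open>pres_eq_invariant\<close> compares values by equality, so the parity
    function is cut off outside the carrier, where nothing is claimed about it.\<close>
  define F where "F w = (prodl (map fst w), \<lambda>t. t \<in> carrier W \<and> par (map fst w) t)" for w :: "'a word"
  have step: "F (u @ r @ v) = F (u @ v)"
    if uv: "u \<in> words S" "v \<in> words S" "r \<in> words S"
      and r: "prodl (map fst r) = \<one>" "\<And>t. t \<in> carrier W \<Longrightarrow> \<not> par (map fst r) t" for u v r
  proof -
    have c: "set (map fst u) \<subseteq> carrier W" "set (map fst v) \<subseteq> carrier W" "set (map fst r) \<subseteq> carrier W"
      using uv S_carrier by (auto dest: words_subset)
    let ?u = "map fst u" and ?v = "map fst v" and ?r = "map fst r"
    have rv: "set (?r @ ?v) \<subseteq> carrier W" using c by auto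
    have "prodl (?r @ ?v) = prodl ?v"
      unfolding prodl_append[OF c(3,2)] r(1) using prodl_closed[OF c(2)] by simp
    then have "prodl (?u @ ?r @ ?v) = prodl (?u @ ?v)"
      by (simp only: prodl_append[OF c(1) rv] prodl_append[OF c(1,2)])
    moreover have "par (?u @ ?r @ ?v) t = par (?u @ ?v) t" if t: "t \<in> carrier W" for t
    proof -
      let ?t = "conjug (inv (prodl ?u)) t"
      have t': "?t \<in> carrier W" using prodl_closed[OF c(1)] t by simp
      have "par (?r @ ?v) ?t = par ?v ?t"
        unfolding par_append[OF c(3,2) t'] r(1) using r(2)[OF t'] t' by simp
      then show ?thesis
        by (simp only: par_append[OF c(1) rv t] par_append[OF c(1,2) t])
    qed
    ultimately show ?thesis
      unfolding F_def map_append by (simp only: cong: conj_cong)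
  qed
  have "F u = F v"
  proof (rule pres_eq_invariant[OF assms(1) coxeter_relators_words assms(2,3)])
    fix u v x b assume "u \<in> words S" "v \<in> words S" "x \<in> S"
    then show "F (u @ [(x, b), (x, \<not> b)] @ v) = F (u @ v)"
      by (intro step) (auto simp: S_square par_def conjug_def)
  next
    fix u v r assume uv: "u \<in> words S" "v \<in> words S" "r \<in> coxeter_relators W S"
    obtain s t m where r: "s \<in> S" "t \<in> S" "(s \<otimes> t) [^] (m :: nat) = \<one>"
      "map fst r = concat (replicate m [s, t])" "r \<in> words S"
      using relatorE uv(3) by metis
    have "prodl (map fst r) = \<one>"
      using r prodl_alternating[of s t m] by (simp add: concat_replicate_alternating)
    then show "F (u @ r @ v) = F (u @ v)"
      using uv r par_relator by (intro step) auto
  qed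
  then show ?thesis by (auto simp: F_def fun_eq_iff)
qed

text \<open>Here the injectivity of the canonical map from the presented group enters: equal
  products force equivalent words, and these have equal parities.\<close>

lemma par_cong:
  assumes "set u \<subseteq> S" "set v \<subseteq> S" "prodl u = prodl v" "t \<in> carrier W"
  shows "par u t = par v t"
proof -
  let ?R = "coxeter_relators W S"
  have eval: "pres_hom W id (pres_class S ?R (letters l)) = prodl l" if l: "set l \<subseteq> S" for l
    using pres_eq_prodl_par[OF some_in_pres_class(2)[OF letters_words[OF l] refl]
        some_in_pres_class(1)[OF letters_words[OF l] refl] letters_words[OF l]]
      some_in_pres_class(1)[OF letters_words[OF l] refl]
    by (simp add: pres_hom_def eval_word_id)
  have "inj_on (pres_hom W id) (carrier (pres_group S ?R))"
    using presentation by (auto simp: iso_def bij_betw_def)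
  then have "pres_class S ?R (letters u) = pres_class S ?R (letters v)"
    by (rule inj_onD) (use assms eval letters_words[of _ S] in \<open>auto simp: carrier_pres_group\<close>)
  then have "pres_eq ?R (letters u) (letters v)"
    using assms letters_words[of _ S] by (simp add: pres_class_eq_iff)
  from pres_eq_prodl_par[OF this] show ?thesis
    using letters_words[of _ S] assms by simp
qed

lemma carrier_prodl:
  assumes "w \<in> carrier W"
  obtains l where "set l \<subseteq> S" "prodl l = w"
proof -
  have "w \<in> pres_hom W id ` carrier (pres_group S (coxeter_relators W S))"
    using presentation assms by (auto simp: iso_def bij_betw_def)
  then obtain u where u: "u \<in> words S" "w = pres_hom W id (pres_class S (coxeter_relators W S) u)"
    by (auto simp: carrier_pres_group)
  define v where "v = (SOME v. v \<in> pres_class S (coxeter_relators W S) u)"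
  have v: "v \<in> words S" unfolding v_def using some_in_pres_class(1)[OF u(1) refl] .
  then have "prodl (map fst v) = w"
    using u(2) by (simp add: pres_hom_def eval_word_id flip: v_def)
  then show ?thesis using that words_subset[OF v] by blast
qed

lemma in_generate_iff:
  assumes "I \<subseteq> S"
  shows "w \<in> generate W I \<longleftrightarrow> (\<exists>l. set l \<subseteq> I \<and> prodl l = w)"
proof
  assume "w \<in> generate W I"
  then show "\<exists>l. set l \<subseteq> I \<and> prodl l = w"
  proof (induction rule: generate.induct)
    case one
    show ?case by (intro exI[of _ "[]"]) auto
  next
    case (incl h)
    then show ?case using assms by (intro exI[of _ "[h]"]) auto
  next
    case (inv h)
    then show ?case using assms by (intro exI[of _ "[h]"]) auto
  next
    case (eng h1 h2)
    then obtain l1 l2 where "set l1 \<subseteq> I" "prodl l1 = h1" "set l2 \<subseteq> I" "prodl l2 = h2" by blast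
    moreover then have "prodl (l1 @ l2) = h1 \<otimes> h2"
      using assms S_carrier by (subst prodl_append) auto
    ultimately show ?case by (intro exI[of _ "l1 @ l2"]) auto
  qed
next
  assume "\<exists>l. set l \<subseteq> I \<and> prodl l = w"
  then obtain l where "set l \<subseteq> I" "prodl l = w" by blast
  then show "w \<in> generate W I"
    by (induction l arbitrary: w) (auto intro: generate.intros)
qed

text \<open>The left inversion set of \<open>w\<close>. By \<open>par_cong\<close> it does not
  depend on the word picked by \<open>SOME\<close>.\<close>

definition inversions :: "'a \<Rightarrow> 'a set" where
  "inversions w = {t \<in> carrier W. par (SOME l. set l \<subseteq> S \<and> prodl l = w) t}"

lemma inversions_prodl:
  assumes "set l \<subseteq> S"
  shows "inversions (prodl l) = {t \<in> carrier W. par l t}"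
proof -
  have "set (SOME l'. set l' \<subseteq> S \<and> prodl l' = prodl l) \<subseteq> S \<and>
      prodl (SOME l'. set l' \<subseteq> S \<and> prodl l' = prodl l) = prodl l"
    by (rule someI[of _ l]) (use assms in auto)
  then show ?thesis unfolding inversions_def using par_cong assms by blast
qed

text \<open>Multiplying on the left by the \<open>i\<close>-th reflection of a word deletes its
  \<open>i\<close>-th letter. The word need not be reduced.\<close>

lemma exchange:
  assumes "set l \<subseteq> S" "t \<in> set (refls l)"
  shows "\<exists>l'. set l' \<subseteq> set l \<and> Suc (length l') = length l \<and> prodl l' = t \<otimes> prodl l"
  using assms
proof (induction l arbitrary: t)
  case (Cons s l)
  have c: "set l \<subseteq> carrier W" using Cons.prems S_carrier by auto
  have s: "s \<in> S" using Cons.prems by simp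
  show ?case
  proof (cases "t = s")
    case True
    then have "prodl l = t \<otimes> prodl (s # l)"
      using S_square[OF s] s c by (simp flip: m_assoc)
    then show ?thesis by (intro exI[of _ l]) auto
  next
    case False
    then obtain t' where t': "t' \<in> set (refls l)" "t = conjug s t'" using Cons.prems by auto
    then obtain l' where l': "set l' \<subseteq> set l" "Suc (length l') = length l" "prodl l' = t' \<otimes> prodl l"
      using Cons.IH[of t'] Cons.prems by auto
    have tc: "t' \<in> carrier W" using t' refls_closed c by auto
    have "t \<otimes> prodl (s # l) = s \<otimes> t' \<otimes> (s \<otimes> s) \<otimes> prodl l"
      using s c tc t' by (simp add: conjug_def m_assoc)
    then have "prodl (s # l') = t \<otimes> prodl (s # l)"
      using s c tc l' S_square[OF s] by (simp add: m_assoc)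
    then show ?thesis using l' by (intro exI[of _ "s # l'"]) auto
  qed
qed simp

text \<open>If a reflection occurs twice, \<open>exchange\<close> gives a shorter word for the same
  element. No new letter is brought in, so the argument stays inside parabolic subgroups.\<close>

lemma deletion:
  assumes "set l \<subseteq> S"
  shows "\<exists>l'. set l' \<subseteq> set l \<and> prodl l' = prodl l \<and> distinct (refls l')"
  using assms
proof (induction "length l" arbitrary: l rule: less_induct)
  case less
  have "distinct (refls l) \<or> (\<exists>l'. set l' \<subseteq> set l \<and> prodl l' = prodl l \<and> length l' < length l)"
    using less.prems
  proof (induction l)
    case (Cons s l)
    have s: "s \<in> S" and c: "set l \<subseteq> carrier W" using Cons.prems S_carrier by auto
    show ?case
    proof (cases "distinct (refls l)")
      case False
      then obtain l' where "set l' \<subseteq> set l" "prodl l' = prodl l" "length l' < length l"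
        using Cons.IH Cons.prems by auto
      then have "set (s # l') \<subseteq> set (s # l) \<and> prodl (s # l') = prodl (s # l) \<and>
          length (s # l') < length (s # l)"
        by auto
      then show ?thesis by blast
    next
      case True
      then have d: "distinct (map (conjug s) (refls l))"
        using inj_on_subset[OF conjug_inj refls_closed[OF c]] s by (simp add: distinct_map)
      show ?thesis
      proof (cases "s \<in> conjug s ` set (refls l)")
        case False
        then show ?thesis using d by simp
      next
        case True
        then obtain t where t: "t \<in> set (refls l)" "s = conjug s t" by auto
        \<comment> \<open>Conjugation by \<open>s\<close> is injective and fixes \<open>s\<close>,
          so a coincidence with the new reflection \<open>s\<close> already means that
          \<open>s\<close> is a reflection of the tail.\<close>
        have "conjug s s = s" using s S_square by (simp add: conjug_def)
        then have "t = s" using t s refls_closed[OF c] conjug_eq_iff[of s s t] by auto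
        then obtain l' where "set l' \<subseteq> set l" "Suc (length l') = length l" "prodl l' = prodl (s # l)"
          using exchange[of l s] t Cons.prems by auto
        then show ?thesis by (intro disjI2 exI[of _ l']) auto
      qed
    qed
  qed simp
  then show ?case
  proof
    assume "\<exists>l'. set l' \<subseteq> set l \<and> prodl l' = prodl l \<and> length l' < length l"
    then obtain l' where l': "set l' \<subseteq> set l" "prodl l' = prodl l" "length l' < length l" by blast
    then show ?thesis using less.hyps[of l'] less.prems by (metis subset_trans)
  qed auto
qed

lemma len_le: "set l \<subseteq> S \<Longrightarrow> len (prodl l) \<le> length l"
  unfolding cox_length_def by (rule Least_le) auto

text \<open>Without repetitions every listed reflection has odd multiplicity and is an inversion.
  Any other word for the element must list all inversions too, so it is at least as long.\<close>

lemma inversions_reduced: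
  assumes "set l \<subseteq> S" "distinct (refls l)"
  shows "inversions (prodl l) = set (refls l)" "len (prodl l) = length l"
proof -
  have par_iff: "par l t \<longleftrightarrow> t \<in> set (refls l)" for t
  proof -
    have "count_list xs x = (if x \<in> set xs then 1 else 0)" if "distinct xs" for x and xs :: "'a list"
      using that by (induction xs) auto
    from this[OF assms(2)] show ?thesis by (simp add: par_def)
  qed
  then show inv: "inversions (prodl l) = set (refls l)"
    using inversions_prodl[OF assms(1)] refls_closed[OF subset_trans[OF assms(1) S_carrier]] by auto
  have "length l \<le> length l'" if l': "set l' \<subseteq> S" "prodl l' = prodl l" for l'
  proof -
    have "inversions (prodl l') \<subseteq> set (refls l')"
      using inversions_prodl[OF l'(1)] by (auto simp: par_def intro: ccontr)
    then have "card (set (refls l)) \<le> card (set (refls l'))"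
      using inv l' by (intro card_mono) auto
    also have "\<dots> \<le> length l'" using card_length[of "refls l'"] by simp
    finally show ?thesis using distinct_card[OF assms(2)] by simp
  qed
  then show "len (prodl l) = length l"
    unfolding cox_length_def by (intro Least_equality) (use assms in auto)
qed

text \<open>Since \<open>deletion\<close> keeps to the given letters, an element of
  \<open>W_I\<close> has a word over \<open>I\<close> that is reduced for the whole of
  \<open>S\<close>.\<close>

lemma reduced_word:
  assumes "I \<subseteq> S" "w \<in> generate W I"
  obtains l where "set l \<subseteq> I" "prodl l = w" "inversions w = set (refls l)" "len w = length l"
    "distinct (refls l)"
proof -
  obtain l where l: "set l \<subseteq> I" "prodl l = w" using assms in_generate_iff by blast
  then obtain l' where "set l' \<subseteq> set l" "prodl l' = w" "distinct (refls l')"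
    using deletion[of l] assms by auto
  moreover then have "set l' \<subseteq> I" "set l' \<subseteq> S" using l assms by auto
  ultimately show ?thesis using that inversions_reduced[of l'] by metis
qed

lemma carrier_eq_generate: "carrier W = generate W S"
proof
  show "carrier W \<subseteq> generate W S"
    using carrier_prodl in_generate_iff[of S] by (metis order_refl subsetI)
  show "generate W S \<subseteq> carrier W"
    using generate_in_carrier S_carrier by blast
qed

lemma inversions_card:
  assumes "w \<in> carrier W"
  shows "finite (inversions w) \<and> card (inversions w) = len w"
proof -
  obtain l where "inversions w = set (refls l)" "len w = length l" "distinct (refls l)"
    using reduced_word[of S w] assms carrier_eq_generate by blast
  then show ?thesis by (simp add: distinct_card)
qed

lemma inversions_carrier: "inversions w \<subseteq> carrier W"
  by (auto simp: inversions_def)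

text \<open>The cocycle identity for inversion sets: a symmetric difference with one part
  conjugated. Most later facts on longest elements are computed from it.\<close>

lemma inversions_mult:
  assumes "u \<in> carrier W" "v \<in> carrier W" "t \<in> carrier W"
  shows "t \<in> inversions (u \<otimes> v) \<longleftrightarrow> (t \<in> inversions u) \<noteq> (conjug (inv u) t \<in> inversions v)"
proof -
  obtain k l where k: "set k \<subseteq> S" "prodl k = u" and l: "set l \<subseteq> S" "prodl l = v"
    using assms carrier_prodl by metis
  then have c: "set k \<subseteq> carrier W" "set l \<subseteq> carrier W" using S_carrier by auto
  have "u \<otimes> v = prodl (k @ l)" using prodl_append[OF c] k l by simp
  then have "inversions (u \<otimes> v) = {t \<in> carrier W. par (k @ l) t}"
    using inversions_prodl[of "k @ l"] k l by simp
  then show ?thesis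
    using par_append[OF c] inversions_prodl[of k] inversions_prodl[of l] k l assms by auto
qed

lemma inversions_one [simp]: "inversions \<one> = {}"
  using inversions_prodl[of "[]"] by (simp add: par_def)

lemma inversions_generator: "s \<in> S \<Longrightarrow> inversions s = {s}"
  using inversions_reduced(1)[of "[s]"] by simp

lemma inversions_inv:
  assumes "u \<in> carrier W" "t \<in> carrier W"
  shows "t \<in> inversions (inv u) \<longleftrightarrow> conjug u t \<in> inversions u"
  using inversions_mult[of "inv u" u t] assms by simp

text \<open>By the cocycle identity, equal inversion sets leave \<open>inv u \<otimes> v\<close>
  without inversions, hence of length 0.\<close>

lemma inversions_inject:
  assumes "u \<in> carrier W" "v \<in> carrier W" "inversions u = inversions v"
  shows "u = v"
proof -
  have "inversions (inv u \<otimes> v) = {}"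
    using inversions_mult[of "inv u" v] inversions_inv[of u] inversions_carrier assms by auto
  then have "len (inv u \<otimes> v) = 0" using inversions_card[of "inv u \<otimes> v"] assms by simp
  then have "inv u \<otimes> v = \<one>"
    using reduced_word[of S "inv u \<otimes> v"] carrier_eq_generate assms
    by (metis foldr_Nil id_apply inv_closed length_0_conv m_closed order_refl)
  then show ?thesis using assms inv_equality[of "inv u" v] by (metis inv_closed inv_inv inv_solve_left r_one)
qed

section \<open>Reflections and longest elements of finite standard parabolic subgroups\<close>

definition reflections :: "'a set \<Rightarrow> 'a set" where
  "reflections I = {conjug x s | x s. x \<in> generate W I \<and> s \<in> I}"

lemma generate_carrier: "I \<subseteq> S \<Longrightarrow> generate W I \<subseteq> carrier W"
  using generate_in_carrier S_carrier by blast

lemma generate_subgroup: "I \<subseteq> S \<Longrightarrow> subgroup (generate W I) W"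
  using generate_is_subgroup S_carrier by blast

lemma conjug_generate:
  assumes "I \<subseteq> S" "u \<in> generate W I" "x \<in> generate W I"
  shows "conjug u x \<in> generate W I"
  using assms subgroup.m_closed[OF generate_subgroup] subgroup.m_inv_closed[OF generate_subgroup]
  by (simp add: conjug_def)

lemma reflections_generate: "I \<subseteq> S \<Longrightarrow> reflections I \<subseteq> generate W I"
  by (auto simp: reflections_def intro: conjug_generate generate.incl)

lemma conjug_reflections:
  assumes I: "I \<subseteq> S" and u: "u \<in> generate W I" and t: "t \<in> reflections I"
  shows "conjug u t \<in> reflections I"
proof -
  obtain x s where x: "x \<in> generate W I" "s \<in> I" "t = conjug x s"
    using t by (auto simp: reflections_def)
  then have "conjug u t = conjug (u \<otimes> x) s"
    using I u generate_carrier[OF I] by (subst conjug_mult) auto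
  then show ?thesis using x u by (auto simp: reflections_def intro: generate.eng)
qed

lemma conjug_reflections_iff:
  assumes "I \<subseteq> S" "u \<in> generate W I" "t \<in> carrier W"
  shows "conjug u t \<in> reflections I \<longleftrightarrow> t \<in> reflections I"
proof
  assume "conjug u t \<in> reflections I"
  moreover have "inv u \<in> generate W I"
    using assms subgroup.m_inv_closed[OF generate_subgroup] by blast
  ultimately have "conjug (inv u) (conjug u t) \<in> reflections I"
    using conjug_reflections assms(1) by blast
  moreover have "u \<in> carrier W" using assms generate_carrier by blast
  ultimately show "t \<in> reflections I" using assms(3) by simp
qed (use assms conjug_reflections in blast)

lemma inversions_subset_reflections:
  assumes I: "I \<subseteq> S" and "w \<in> generate W I"
  shows "inversions w \<subseteq> reflections I"
proof -
  obtain l where l: "set l \<subseteq> I" "inversions w = set (refls l)"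
    using reduced_word assms by metis
  have "set (refls l) \<subseteq> reflections I"
    using l(1)
  proof (induction l)
    case (Cons s l)
    have "conjug \<one> s = s" using Cons.prems I by auto
    then have s: "s \<in> reflections I"
      unfolding reflections_def using Cons.prems generate.one[of W I]
      by (intro CollectI exI[of _ \<one>] exI[of _ s]) simp
    have "set (refls l) \<subseteq> reflections I" using Cons by simp
    moreover have "s \<in> generate W I" using Cons.prems by (auto intro: generate.incl)
    ultimately show ?case using s conjug_reflections[OF I] by auto
  qed simp
  then show ?thesis using l by simp
qed

lemma len_reflection_mult:
  assumes w: "w \<in> carrier W" and t: "t \<in> inversions w"
  shows "len (t \<otimes> w) < len w"
proof -
  have "w \<in> generate W S" using w carrier_eq_generate by simp
  then obtain l where l: "set l \<subseteq> S" "prodl l = w" "inversions w = set (refls l)" "len w = length l"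
    using reduced_word[OF order_refl] by metis
  then obtain l' where "set l' \<subseteq> set l" "Suc (length l') = length l" "prodl l' = t \<otimes> w"
    using exchange[of l t] t by auto
  moreover then have "len (t \<otimes> w) \<le> length l'" using len_le[of l'] l by auto
  ultimately show ?thesis using l by simp
qed

text \<open>For \<open>t = conjug x s\<close> the cocycle identity gives contributions from
  \<open>x\<close>, \<open>s\<close> and \<open>inv x\<close>. The first and the last cancel, which
  leaves that of \<open>s\<close>.\<close>

lemma reflection_in_inversions:
  assumes I: "I \<subseteq> S" and t: "t \<in> reflections I"
  shows "t \<in> inversions t" "t \<otimes> t = \<one>"
proof -
  obtain x s where x: "x \<in> carrier W" "s \<in> S" "t = conjug x s"
    using assms generate_carrier[OF I] by (auto simp: reflections_def)
  have t_eq: "x \<otimes> (s \<otimes> inv x) = t" using x by (simp add: conjug_def m_assoc)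
  have "conjug (inv x) t = s" using x by simp
  moreover have "t \<in> carrier W" using x by simp
  ultimately have "t \<in> inversions t \<longleftrightarrow> (t \<in> inversions x) \<noteq> (s \<in> inversions (s \<otimes> inv x))"
    using inversions_mult[of x "s \<otimes> inv x" t] x(1,2) unfolding t_eq by simp
  moreover have "conjug s s = s" using x by (simp add: conjug_def S_square)
  then have "s \<in> inversions (s \<otimes> inv x) \<longleftrightarrow> t \<notin> inversions x"
    using inversions_mult[of s "inv x" s] inversions_inv[of x s] inversions_generator[of s] x by simp
  ultimately show "t \<in> inversions t" by blast
  interpret h: group_hom W W "conjug x" using conjug_hom x by blast
  show "t \<otimes> t = \<one>"
    using h.hom_mult[of s s] x by (simp add: S_square)
qed

text \<open>Take \<open>w\<close> of maximal length. A reflection \<open>t\<close> that is not an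
  inversion of \<open>w\<close> would be one of \<open>t \<otimes> w\<close>, making
  \<open>w = t \<otimes> (t \<otimes> w)\<close> shorter than \<open>t \<otimes> w\<close>.\<close>

lemma ex_longest:
  assumes I: "I \<subseteq> S" and fin: "finite (generate W I)"
  shows "\<exists>w \<in> generate W I. inversions w = reflections I"
proof -
  obtain w where w: "w \<in> generate W I" "\<And>v. v \<in> generate W I \<Longrightarrow> len v \<le> len w"
  proof -
    have "Max (len ` generate W I) \<in> len ` generate W I"
      using fin generate.one[of W I] by (intro Max_in) auto
    then obtain w where "w \<in> generate W I" "len w = Max (len ` generate W I)" by auto
    then show ?thesis using that fin by simp
  qed
  have "t \<in> inversions w" if t: "t \<in> reflections I" for t
  proof (rule ccontr)
    assume n: "t \<notin> inversions w"
    have c: "t \<in> carrier W" "w \<in> carrier W"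
      using t w reflections_generate generate_carrier I by blast+
    have tt: "t \<in> inversions t" "t \<otimes> t = \<one>" using reflection_in_inversions[OF I t] by auto
    have "inv t = t" using tt c by (simp add: inv_equality)
    then have "conjug (inv t) t = t" using c tt by (simp add: conjug_def)
    then have "t \<in> inversions (t \<otimes> w)" using inversions_mult[of t w t] c tt n by simp
    then have "len (t \<otimes> (t \<otimes> w)) < len (t \<otimes> w)"
      using len_reflection_mult c by simp
    moreover have "t \<otimes> (t \<otimes> w) = w" using tt c by (simp flip: m_assoc)
    moreover have "t \<otimes> w \<in> generate W I"
      using t w reflections_generate[OF I] by (auto intro: generate.eng)
    ultimately show False using w(2)[of "t \<otimes> w"] by simp
  qed
  then show ?thesis using inversions_subset_reflections[OF I w(1)] w(1) by blast
qed

text \<open>Every other element of \<open>W_I\<close> has a strictly smaller inversion set and so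
  smaller length. Longest elements are henceforth recognised by inversion sets rather than by the
  \<open>THE\<close> description.\<close>

lemma longest_eqI:
  assumes I: "I \<subseteq> S" and w: "w \<in> generate W I" "inversions w = reflections I"
  shows "longest W S I = w"
proof -
  have c: "w \<in> carrier W" using w generate_carrier[OF I] by blast
  have less: "len v < len w" if v: "v \<in> generate W I" "v \<noteq> w" for v
  proof -
    have vc: "v \<in> carrier W" using v generate_carrier[OF I] by blast
    have "inversions v \<subset> inversions w"
      using inversions_subset_reflections[OF I v(1)] w inversions_inject[OF vc c] v(2) by auto
    then show ?thesis
      using psubset_card_mono inversions_card[OF c] inversions_card[OF vc] by metis
  qed
  show ?thesis unfolding longest_def
  proof (rule the_equality)
    fix v assume "v \<in> generate W I \<and> (\<forall>u\<in>generate W I. u \<noteq> v \<longrightarrow> len u < len v)"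
    then show "v = w" using less[of v] w(1) by (metis less_asym)
  qed (use w(1) less in auto)
qed

lemma longest:
  assumes "I \<subseteq> S" "finite (generate W I)"
  shows "longest W S I \<in> generate W I" "inversions (longest W S I) = reflections I"
  using ex_longest[OF assms] longest_eqI[OF assms(1)] by auto

lemma longest_closed:
  "I \<subseteq> S \<Longrightarrow> finite (generate W I) \<Longrightarrow> longest W S I \<in> carrier W"
  using longest generate_carrier by blast

text \<open>The reflections of \<open>W_I\<close> are stable under conjugation by
  \<open>W_I\<close>, so the inverse has the same inversion set.\<close>

lemma inv_longest:
  assumes I: "I \<subseteq> S" and fin: "finite (generate W I)"
  shows "inv (longest W S I) = longest W S I"
proof (rule longest_eqI[symmetric, OF I])
  let ?w = "longest W S I"
  have c: "?w \<in> carrier W" using longest_closed assms .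
  show "inv ?w \<in> generate W I"
    using subgroup.m_inv_closed[OF generate_subgroup] longest assms by blast
  show "inversions (inv ?w) = reflections I"
    using inversions_inv[OF c] longest[OF assms] conjug_reflections_iff[OF I longest(1)[OF assms]]
      inversions_carrier reflections_generate[OF I] generate_carrier[OF I]
    by blast
qed

lemma longest_square:
  "I \<subseteq> S \<Longrightarrow> finite (generate W I) \<Longrightarrow> longest W S I \<otimes> longest W S I = \<one>"
  using inv_longest longest_closed r_inv by metis

text \<open>In \<open>w \<otimes> (x \<otimes> w)\<close> each factor \<open>w\<close> contributes
  all reflections of \<open>W_J\<close>. This set is stable under conjugation by \<open>W_J\<close>,
  so the two contributions cancel.\<close>

lemma inversions_conj_longest:
  assumes J: "J \<subseteq> S" and fin: "finite (generate W J)" and x: "x \<in> generate W J"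
  defines "w \<equiv> longest W S J"
  shows "inversions (conjug w x) = conjug w ` inversions x"
proof -
  have w: "w \<in> generate W J" "inversions w = reflections J" "inv w = w"
    using longest[OF J fin] inv_longest[OF J fin] by (simp_all add: w_def)
  have wc: "w \<in> carrier W" and xc: "x \<in> carrier W" using w x generate_carrier[OF J] by auto
  have ix: "inv x \<in> generate W J"
    using subgroup.m_inv_closed[OF generate_subgroup[OF J]] x by blast
  have ww: "conjug w (conjug w t) = t" if "t \<in> carrier W" for t
    using conjug_inv(1)[OF wc that] w(3) by simp
  have iff: "t \<in> inversions (conjug w x) \<longleftrightarrow> conjug w t \<in> inversions x" if t: "t \<in> carrier W" for t
  proof -
    have wt: "conjug w t \<in> carrier W" using wc t by simp
    have "w \<otimes> (x \<otimes> w) = conjug w x" using wc xc w(3) by (simp add: conjug_def m_assoc)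
    then have "t \<in> inversions (conjug w x) \<longleftrightarrow> (t \<in> reflections J) \<noteq> (conjug w t \<in> inversions (x \<otimes> w))"
      using inversions_mult[OF wc m_closed[OF xc wc] t] w(2,3) by simp
    moreover have "conjug w t \<in> inversions (x \<otimes> w) \<longleftrightarrow>
        (conjug w t \<in> inversions x) \<noteq> (t \<in> reflections J)"
      using inversions_mult[OF xc wc wt] conjug_reflections_iff[OF J ix wt]
        conjug_reflections_iff[OF J w(1) t] w(2) by simp
    ultimately show ?thesis by blast
  qed
  show ?thesis
  proof (intro Set.set_eqI iffI)
    fix t assume t: "t \<in> inversions (conjug w x)"
    then have tc: "t \<in> carrier W" using inversions_carrier by blast
    then show "t \<in> conjug w ` inversions x" using iff[OF tc] t ww[OF tc] by (metis image_eqI)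
  next
    fix t assume "t \<in> conjug w ` inversions x"
    then obtain r where r: "r \<in> inversions x" "t = conjug w r" by blast
    then have "r \<in> carrier W" using inversions_carrier by blast
    then show "t \<in> inversions (conjug w x)" using iff[of t] ww[of r] r wc by simp
  qed
qed

lemma generate_Int_S:
  assumes I: "I \<subseteq> S" and x: "x \<in> generate W I" and len: "len x = 1"
  shows "x \<in> I"
proof -
  obtain l where l: "set l \<subseteq> I" "prodl l = x" "len x = length l"
    using reduced_word I x by metis
  then obtain s where "l = [s]" using len by (metis One_nat_def length_0_conv length_Suc_conv)
  then show ?thesis using l I by auto
qed

text \<open>\<open>W_I\<close> determines \<open>I\<close>, whose members are its elements of length
  1. This later recovers cactus labels from their parabolic subgroups.\<close>

lemma generate_subset_iff:
  assumes I: "I \<subseteq> S" and J: "J \<subseteq> S"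
  shows "generate W I \<subseteq> generate W J \<longleftrightarrow> I \<subseteq> J"
proof
  assume sub: "generate W I \<subseteq> generate W J"
  show "I \<subseteq> J"
  proof
    fix s assume s: "s \<in> I"
    then have "s \<in> S" using I by blast
    then have "len s = 1" using inversions_card[of s] inversions_generator[of s] by simp
    then show "s \<in> J" using generate_Int_S[OF J] s sub generate.incl[of s I W] by blast
  qed
qed (rule mono_generate)

text \<open>Conjugation by the longest element keeps the number of inversions, so a generator goes
  to an element of length 1 in \<open>W_J\<close>, which is a generator in \<open>J\<close>.\<close>

lemma conjug_longest_subset:
  assumes J: "J \<subseteq> S" and fin: "finite (generate W J)"
  shows "conjug (longest W S J) ` J \<subseteq> J"
proof
  let ?w = "longest W S J"
  fix x assume "x \<in> conjug ?w ` J"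
  then obtain s where s: "s \<in> J" "x = conjug ?w s" by auto
  have x: "x \<in> generate W J"
    using conjug_generate[OF J longest(1)[OF J fin]] s by (auto intro: generate.incl)
  have "s \<in> generate W J" "inversions s = {s}"
    using s J inversions_generator by (auto intro: generate.incl)
  then have "inversions x = {x}" using inversions_conj_longest[OF J fin, of s] s by simp
  then have "len x = 1" using inversions_card[of x] x generate_carrier[OF J] by auto
  then show "x \<in> J" using generate_Int_S J x by blast
qed

lemma generate_conj:
  assumes "u \<in> carrier W" "I \<subseteq> carrier W"
  shows "generate W (conjug u ` I) = conjug u ` generate W I"
  using group_hom.generate_img[OF conjug_hom[OF assms(1)] assms(2)] by simp

lemma reflections_conj:
  assumes u: "u \<in> carrier W" and I: "I \<subseteq> S"
  shows "reflections (conjug u ` I) = conjug u ` reflections I"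
proof -
  interpret h: group_hom W W "conjug u" using conjug_hom u by blast
  have eq: "conjug (conjug u x) (conjug u s) = conjug u (conjug x s)" if "x \<in> carrier W" "s \<in> carrier W" for x s
    using that by (simp add: conjug_def[of "conjug u x"] conjug_def[of x])
  have gen: "generate W (conjug u ` I) = conjug u ` generate W I"
    using generate_conj[OF u, of I] I S_carrier by auto
  have "reflections (conjug u ` I) = (\<Union>x\<in>generate W I. \<Union>s\<in>I. {conjug (conjug u x) (conjug u s)})"
    unfolding reflections_def gen by blast
  also have "\<dots> = (\<Union>x\<in>generate W I. \<Union>s\<in>I. {conjug u (conjug x s)})"
    using eq generate_carrier[OF I] I S_carrier by (intro SUP_cong refl) blast
  also have "\<dots> = conjug u ` reflections I"
    unfolding reflections_def by blast
  finally show ?thesis .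
qed

text \<open>Both sides have the conjugated reflections of \<open>W_I\<close> as inversion
  set.\<close>

lemma longest_conj_longest:
  assumes J: "J \<subseteq> S" and fin: "finite (generate W J)" and I: "I \<subseteq> J"
  defines "w \<equiv> longest W S J"
  shows "longest W S (conjug w ` I) = conjug w (longest W S I)"
proof (rule longest_eqI)
  have sub: "generate W I \<subseteq> generate W J" using I by (rule mono_generate)
  have IS: "I \<subseteq> S" and finI: "finite (generate W I)"
    using I J fin finite_subset[OF sub] by auto
  have wc: "w \<in> carrier W" using longest_closed[OF J fin] by (simp add: w_def)
  show "conjug w ` I \<subseteq> S"
    using conjug_longest_subset[OF J fin] I J unfolding w_def by blast
  have "longest W S I \<in> generate W I" using longest(1)[OF IS finI] .
  then show "conjug w (longest W S I) \<in> generate W (conjug w ` I)"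
    using generate_conj[OF wc, of I] IS S_carrier by auto
  have "longest W S I \<in> generate W J" using longest(1)[OF IS finI] sub by blast
  then have "inversions (conjug w (longest W S I)) = conjug w ` inversions (longest W S I)"
    unfolding w_def by (rule inversions_conj_longest[OF J fin])
  then show "inversions (conjug w (longest W S I)) = reflections (conjug w ` I)"
    by (simp only: longest(2)[OF IS finI] reflections_conj[OF wc IS])
qed

section \<open>The cactus group\<close>

abbreviation conn :: "'a set set" where
  "conn \<equiv> conn_subsets W S"

abbreviation long :: "'a set \<Rightarrow> 'a" where
  "long \<equiv> longest W S"

section \<open>Independent subgroups and connected subsets under conjugation\<close>

definition indep :: "'a set \<Rightarrow> 'a set \<Rightarrow> bool" where
  "indep A B \<longleftrightarrow> A \<inter> B = {\<one>} \<and> (\<forall>x\<in>A. \<forall>y\<in>B. x \<otimes> y = y \<otimes> x)"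

lemma is_dprod_iff: "is_dprod W I J \<longleftrightarrow> indep (generate W I) (generate W J)"
  by (auto simp: is_dprod_def indep_def)

lemma m_two_iff: "m_two W A B \<longleftrightarrow> A \<subset> B \<or> B \<subset> A \<or> indep A B"
  by (simp add: m_two_def indep_def)

lemma indep_sym: "indep A B \<Longrightarrow> indep B A"
  by (auto simp: indep_def)

lemma m_two_sym: "m_two W A B \<Longrightarrow> m_two W B A"
  using indep_sym by (auto simp: m_two_iff)

lemma conjug_image_mult:
  assumes "u \<in> carrier W" "v \<in> carrier W" "A \<subseteq> carrier W"
  shows "conjug (u \<otimes> v) ` A = conjug u ` conjug v ` A"
  using assms by (force simp: image_image conjug_mult intro: image_cong)

lemma conjug_image_closed: "u \<in> carrier W \<Longrightarrow> A \<subseteq> carrier W \<Longrightarrow> conjug u ` A \<subseteq> carrier W"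
  by auto

lemma conjug_image_inv:
  assumes "u \<in> carrier W" "A \<subseteq> carrier W"
  shows "conjug (inv u) ` conjug u ` A = A" "conjug u ` conjug (inv u) ` A = A"
  using assms by (force simp: image_image subset_iff)+

lemma conjug_image_eq_iff:
  assumes "u \<in> carrier W" "A \<subseteq> carrier W" "B \<subseteq> carrier W"
  shows "conjug u ` A = conjug u ` B \<longleftrightarrow> A = B"
  by (rule inj_on_image_eq_iff[OF conjug_inj]) (use assms in auto)

lemma indep_conjug:
  assumes u: "u \<in> carrier W" and A: "A \<subseteq> carrier W" and B: "B \<subseteq> carrier W" and AB: "indep A B"
  shows "indep (conjug u ` A) (conjug u ` B)"
proof -
  interpret h: group_hom W W "conjug u" using conjug_hom u by blast
  have "conjug u ` A \<inter> conjug u ` B = conjug u ` (A \<inter> B)"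
    by (rule inj_on_image_Int[OF conjug_inj[OF u] A B, symmetric])
  moreover have "conjug u x \<otimes> conjug u y = conjug u y \<otimes> conjug u x" if "x \<in> A" "y \<in> B" for x y
  proof -
    have "x \<in> carrier W" "y \<in> carrier W" "x \<otimes> y = y \<otimes> x"
      using that A B AB by (auto simp: indep_def)
    then show ?thesis by (metis h.hom_mult)
  qed
  ultimately show ?thesis using AB by (auto simp: indep_def)
qed

lemma m_two_conjug:
  assumes u: "u \<in> carrier W" and A: "A \<subseteq> carrier W" and B: "B \<subseteq> carrier W" and AB: "m_two W A B"
  shows "m_two W (conjug u ` A) (conjug u ` B)"
proof -
  consider "A \<subset> B" | "B \<subset> A" | "indep A B" using AB by (auto simp: m_two_iff)
  then show ?thesis
  proof cases
    case 1
    then have "conjug u ` A \<subset> conjug u ` B"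
      by (rule image_strict_mono[OF inj_on_subset[OF conjug_inj[OF u] B]])
    then show ?thesis by (simp add: m_two_iff)
  next
    case 2
    then have "conjug u ` B \<subset> conjug u ` A"
      by (rule image_strict_mono[OF inj_on_subset[OF conjug_inj[OF u] A]])
    then show ?thesis by (simp add: m_two_iff)
  next
    case 3
    then show ?thesis using indep_conjug[OF u A B] by (simp add: m_two_iff)
  qed
qed

lemma m_two_conjug_iff:
  assumes "u \<in> carrier W" "A \<subseteq> carrier W" "B \<subseteq> carrier W"
  shows "m_two W (conjug u ` A) (conjug u ` B) \<longleftrightarrow> m_two W A B"
  using m_two_conjug[of "inv u" "conjug u ` A" "conjug u ` B"] m_two_conjug[OF assms]
    conjug_image_inv(1)[of u] conjug_image_closed[of u] assms by auto

lemma connD: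
  assumes "I \<in> conn"
  shows "I \<subseteq> S" "finite (generate W I)" "I \<noteq> {}"
  using assms by (auto simp: conn_subsets_def connected_subset_def)

lemma conn_indecomposable:
  "I \<in> conn \<Longrightarrow> A \<noteq> {} \<Longrightarrow> B \<noteq> {} \<Longrightarrow> A \<inter> B = {} \<Longrightarrow> I = A \<union> B \<Longrightarrow> \<not> is_dprod W A B"
  unfolding conn_subsets_def connected_subset_def by blast

lemma connI:
  assumes "I \<noteq> {}" "I \<subseteq> S" "finite (generate W I)"
    "\<And>A B. A \<noteq> {} \<Longrightarrow> B \<noteq> {} \<Longrightarrow> A \<inter> B = {} \<Longrightarrow> I = A \<union> B \<Longrightarrow> \<not> is_dprod W A B"
  shows "I \<in> conn"
  unfolding conn_subsets_def connected_subset_def using assms by blast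

lemma conn_generate_carrier: "I \<in> conn \<Longrightarrow> generate W I \<subseteq> carrier W"
  using connD(1) generate_carrier by blast

lemma long_closed [simp]: "I \<in> conn \<Longrightarrow> long I \<in> carrier W"
  using connD longest_closed by blast

lemma long_square [simp]: "I \<in> conn \<Longrightarrow> long I \<otimes> long I = \<one>"
  using connD longest_square by blast

lemma inv_long [simp]: "I \<in> conn \<Longrightarrow> inv (long I) = long I"
  using connD inv_longest by blast

lemma conjug_long_long:
  "I \<in> conn \<Longrightarrow> A \<subseteq> carrier W \<Longrightarrow> conjug (long I) ` conjug (long I) ` A = A"
  using conjug_image_inv(1)[of "long I" A] by simp

lemma conjug_image_generate:
  assumes I: "I \<subseteq> S" and u: "u \<in> generate W I"
  shows "conjug u ` generate W I = generate W I"
proof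
  show "conjug u ` generate W I \<subseteq> generate W I"
    using conjug_generate[OF I u] by blast
  have "inv u \<in> generate W I" using subgroup.m_inv_closed[OF generate_subgroup[OF I] u] .
  moreover have uc: "u \<in> carrier W" using u generate_carrier[OF I] by blast
  ultimately have "conjug u ` conjug (inv u) ` generate W I \<subseteq> conjug u ` generate W I"
    using conjug_generate[OF I] by blast
  then show "generate W I \<subseteq> conjug u ` generate W I"
    using conjug_image_inv(2)[OF uc generate_carrier[OF I]] by simp
qed

lemma conjug_long_generate:
  assumes "I \<in> conn" "J \<subseteq> S" "I \<subseteq> J"
  shows "conjug (long I) ` generate W J = generate W J"
  using conjug_image_generate[OF assms(2)] longest(1)[OF connD(1,2)[OF assms(1)]]
    mono_generate[OF assms(3)] by blast

lemma conjug_commute: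
  "u \<in> carrier W \<Longrightarrow> x \<in> carrier W \<Longrightarrow> u \<otimes> x = x \<otimes> u \<Longrightarrow> conjug u x = x"
  by (simp add: conjug_def m_assoc)

lemma conjug_indep:
  assumes "indep A B" "A \<subseteq> carrier W" "B \<subseteq> carrier W" "u \<in> A"
  shows "x \<in> B \<Longrightarrow> conjug u x = x" "conjug u ` B = B"
proof -
  show *: "conjug u x = x" if "x \<in> B" for x
    using assms that by (intro conjug_commute) (auto simp: indep_def)
  then show "conjug u ` B = B" by force
qed

lemma conj_longest_eq:
  assumes "J \<in> conn"
  shows "conj_longest W S J I = conjug (long J) ` I"
  using assms by (simp add: conj_longest_def conjug_def)

text \<open>Conjugation by \<open>long J\<close> is an involution, so a decomposition of the image
  would carry back to one of \<open>I\<close>.\<close>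

lemma conn_conjug:
  assumes I: "I \<in> conn" and J: "J \<in> conn" and IJ: "I \<subseteq> J"
  shows "conjug (long J) ` I \<in> conn"
proof -
  let ?w = "long J"
  have wc: "?w \<in> carrier W" using J by simp
  have IS: "I \<subseteq> S" and IC: "I \<subseteq> carrier W" using connD(1)[OF I] S_carrier by auto
  have sub: "conjug ?w ` I \<subseteq> S"
    using conjug_longest_subset[OF connD(1,2)[OF J]] IJ connD(1)[OF J] by blast
  show ?thesis
  proof (rule connI)
    show "conjug ?w ` I \<noteq> {}" using connD(3)[OF I] by simp
    show "conjug ?w ` I \<subseteq> S" by (rule sub)
    show "finite (generate W (conjug ?w ` I))"
      using generate_conj[OF wc IC] connD(2)[OF I] by simp
  next
    fix A B assume AB: "A \<noteq> {}" "B \<noteq> {}" "A \<inter> B = {}" "conjug ?w ` I = A \<union> B"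
    have c: "A \<subseteq> carrier W" "B \<subseteq> carrier W" using AB(4) sub S_carrier by blast+
    have gc: "generate W A \<subseteq> carrier W" "generate W B \<subseteq> carrier W"
      using c generate_in_carrier by blast+
    have "conjug ?w ` (A \<union> B) = I" using conjug_long_long[OF J IC] AB(4) by simp
    then have "I = conjug ?w ` A \<union> conjug ?w ` B" by (simp add: image_Un)
    moreover have "conjug ?w ` A \<inter> conjug ?w ` B = {}"
      using inj_on_image_Int[OF conjug_inj[OF wc] c] AB(3) by simp
    ultimately have "\<not> is_dprod W (conjug ?w ` A) (conjug ?w ` B)"
      using AB(1,2) by (intro conn_indecomposable[OF I]) simp_all
    then show "\<not> is_dprod W A B"
      using indep_conjug[OF wc gc] generate_conj[OF wc] c by (auto simp: is_dprod_iff)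
  qed
qed

text \<open>These are the facts that make a cactus relation hold in the semidirect product. In the
  independent case conjugation acts trivially and \<open>K = I\<close>; the equality in the last
  item accounts for \<open>I = J\<close>.\<close>

lemma cactus_relation:
  assumes I: "I \<in> conn" and J: "J \<in> conn" and IJ: "I \<subseteq> J \<or> indep (generate W I) (generate W J)"
  defines "K \<equiv> conj_longest W S J I"
  shows "K \<in> conn" "long K = conjug (long J) (long I)"
    "generate W K = conjug (long J) ` generate W I"
    "conjug (long I) ` generate W J = generate W J"
    "m_two W (generate W I) (generate W J) \<or> generate W I = generate W J"
proof -
  have K: "K = conjug (long J) ` I" using conj_longest_eq[OF J] by (simp add: K_def)
  have IC: "I \<subseteq> carrier W" using connD(1)[OF I] S_carrier by auto
  show "generate W K = conjug (long J) ` generate W I"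
    using generate_conj[OF _ IC] J by (simp add: K)
  have li: "long I \<in> generate W I" and lj: "long J \<in> generate W J"
    using longest(1) connD I J by blast+
  have "K \<in> conn \<and> long K = conjug (long J) (long I) \<and>
    conjug (long I) ` generate W J = generate W J \<and>
    (m_two W (generate W I) (generate W J) \<or> generate W I = generate W J)"
    using IJ
  proof
    assume IJ: "I \<subseteq> J"
    then have "generate W I \<subset> generate W J \<or> generate W I = generate W J"
      using mono_generate[OF IJ] by blast
    then have "m_two W (generate W I) (generate W J) \<or> generate W I = generate W J"
      by (auto simp: m_two_iff)
    then show ?thesis
      unfolding K
      by (intro conjI conn_conjug[OF I J IJ] longest_conj_longest[OF connD(1,2)[OF J] IJ]
          conjug_long_generate[OF I connD(1)[OF J] IJ])
  next
    assume ind: "indep (generate W I) (generate W J)"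
    note c = conn_generate_carrier[OF I] conn_generate_carrier[OF J]
    note ji = conjug_indep(1)[OF indep_sym[OF ind] c(2,1) lj]
    have "conjug (long J) x = x" if "x \<in> I" for x
      by (rule ji) (rule generate.incl[OF that])
    then have KI: "K = I" unfolding K by (simp cong: image_cong)
    show ?thesis
      unfolding KI m_two_iff ji[OF li] conjug_indep(2)[OF ind c li] using I ind by simp
  qed
  then show "K \<in> conn" "long K = conjug (long J) (long I)"
    "conjug (long I) ` generate W J = generate W J"
    "m_two W (generate W I) (generate W J) \<or> generate W I = generate W J"
    by blast+
qed

section \<open>Cactus words and their images in the right-angled group\<close>

lemma pres_eq_cactus_square:
  assumes "I \<in> conn"
  shows "pres_eq (cactus_relators W S) (u @ letters [I, I] @ v) (u @ v)"
  using assms by (intro pres_rel) (auto simp: cactus_relators_def letters_def)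

lemma pres_eq_cactus_swap:
  assumes "I \<in> conn" "J \<in> conn" "I \<subseteq> J \<or> is_dprod W I J"
  shows "pres_eq (cactus_relators W S) (letters [I, J]) (letters [J, conj_longest W S J I])"
proof (rule pres_eq_cancel_right)
  have "letters [I, J] @ inv_word (letters [J, conj_longest W S J I]) \<in> cactus_relators W S"
    using assms by (auto simp: cactus_relators_def letters_def inv_word_def)
  from pres_rel[OF this, of "[]" "[]"]
  show "pres_eq (cactus_relators W S) (letters [I, J] @ inv_word (letters [J, conj_longest W S J I])) []"
    by simp
qed

text \<open>Reducing \<open>I\<^sup>-\<^sup>1 I I\<close> once by the square relator and once by
  free cancellation identifies a generator with its inverse.\<close>

lemma pres_eq_letters:
  assumes "w \<in> words conn"
  shows "pres_eq (cactus_relators W S) w (letters (map fst w))"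
  using assms
proof (induction w rule: list.induct)
  case Nil
  show ?case by (simp add: letters_def pres_refl)
next
  case (Cons a w)
  obtain I b where "a = (I, b)" by force
  then have a: "a = (I, b)" "I \<in> conn" using Cons.prems by simp_all
  have "pres_eq (cactus_relators W S) [(I, True), (I, False), (I, False)] [(I, True)]"
    using pres_eq_cactus_square[OF a(2), of "[(I, True)]" "[]"] by (simp add: letters_def)
  moreover have "pres_eq (cactus_relators W S) [(I, True), (I, False), (I, False)] [(I, False)]"
    using pres_cancel[of _ "[]" I True "[(I, False)]"] by simp
  ultimately have "pres_eq (cactus_relators W S) [(I, True)] [(I, False)]"
    using pres_sym pres_trans by blast
  then have "pres_eq (cactus_relators W S) [a] [(I, False)]"
    using a pres_refl by (cases b) auto
  then have "pres_eq (cactus_relators W S) ([a] @ w) ([(I, False)] @ letters (map fst w))"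
    using Cons by (intro pres_eq_append) auto
  then show ?case using a by (simp add: letters_def)
qed

text \<open>First component of the image in the semidirect product. The base point \<open>u\<close>
  is the product of the longest elements read so far; it acts on the next generator by
  conjugation.\<close>

fun parabs :: "'a \<Rightarrow> 'a set list \<Rightarrow> 'a set list" where
  "parabs u [] = []"
| "parabs u (I # l) = conjug u ` generate W I # parabs (u \<otimes> long I) l"

definition lprod :: "'a set list \<Rightarrow> 'a" where
  "lprod l = prodl (map long l)"

lemma lprod_closed [simp]: "set l \<subseteq> conn \<Longrightarrow> lprod l \<in> carrier W"
  unfolding lprod_def by (rule prodl_closed) auto

lemma lprod_simps [simp]: "lprod [] = \<one>" "lprod (I # l) = long I \<otimes> lprod l"
  by (simp_all add: lprod_def)

lemma lprod_append:
  "set l \<subseteq> conn \<Longrightarrow> set l' \<subseteq> conn \<Longrightarrow> lprod (l @ l') = lprod l \<otimes> lprod l'"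
  unfolding lprod_def map_append by (rule prodl_append) auto

lemma parabs_append:
  "u \<in> carrier W \<Longrightarrow> set l \<subseteq> conn \<Longrightarrow> set l' \<subseteq> conn \<Longrightarrow>
    parabs u (l @ l') = parabs u l @ parabs (u \<otimes> lprod l) l'"
  by (induction l arbitrary: u) (auto simp: m_assoc)

lemma set_parabs:
  "u \<in> carrier W \<Longrightarrow> set l \<subseteq> conn \<Longrightarrow> set (parabs u l) \<subseteq> conj_parabolics W S"
proof (induction l arbitrary: u)
  case (Cons I l)
  have "conjug u ` generate W I \<in> conj_parabolics W S"
    using Cons.prems unfolding conj_parabolics_def conjug_def by auto
  then show ?case using Cons by simp
qed simp

lemma eval_word_long: "w \<in> words conn \<Longrightarrow> eval_word W long w = lprod (map fst w)"
  by (induction w) (auto simp: eval_word_def lprod_def)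

lemma conj_parabolics_eq: "conj_parabolics W S = {conjug u ` generate W I | u I. u \<in> carrier W \<and> I \<in> conn}"
  by (simp add: conj_parabolics_def conjug_def)

lemma parabs_square:
  assumes "x \<in> carrier W" "I \<in> conn"
  shows "pres_eq (RACG_relators W S) (letters (parabs x [I, I])) []"
proof -
  have "conjug (x \<otimes> long I) ` generate W I = conjug x ` generate W I"
    using assms conjug_image_mult conn_generate_carrier conjug_long_generate[of I I] connD(1) by simp
  moreover have "conjug x ` generate W I \<in> conj_parabolics W S"
    using assms by (auto simp: conj_parabolics_eq)
  ultimately have "letters (parabs x [I, I]) \<in> RACG_relators W S"
    by (auto simp: RACG_relators_def letters_def)
  from pres_rel[OF this, of "[]" "[]"] show ?thesis by simp
qed

text \<open>Without its flags the cactus relator reads \<open>I, J, K, J\<close>, and its image is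
  \<open>?A, ?B, ?A, ?B\<close> from any base point.\<close>

lemma parabs_relator:
  assumes x: "x \<in> carrier W" and I: "I \<in> conn" and J: "J \<in> conn"
    and IJ: "I \<subseteq> J \<or> indep (generate W I) (generate W J)"
  defines "K \<equiv> conj_longest W S J I"
  shows "pres_eq (RACG_relators W S) (letters (parabs x [I, J, K, J])) []"
    and "lprod [I, J, K, J] = \<one>"
proof -
  note K = cactus_relation[OF I J IJ, folded K_def]
  note [simp] = I J x
  note c = conn_generate_carrier[OF I] conn_generate_carrier[OF J] conn_generate_carrier[OF K(1)]
  let ?A = "conjug x ` generate W I" and ?B = "conjug x ` generate W J"
  have long_K: "long K = long J \<otimes> (long I \<otimes> long J)"
    using K(2) by (simp add: conjug_def m_assoc)
  have cancel: "a \<otimes> (a \<otimes> b) = b" if "a \<in> carrier W" "b \<in> carrier W" "a \<otimes> a = \<one>" for a b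
    using that by (simp flip: m_assoc)
  have prod: "long I \<otimes> (long J \<otimes> long K) = long J"
    by (simp add: long_K cancel m_assoc)
  have "lprod [I, J, K, J] = long I \<otimes> (long J \<otimes> long K) \<otimes> long J"
    using K(1) by (simp add: m_assoc)
  then show "lprod [I, J, K, J] = \<one>" by (simp add: prod)
  have B2: "conjug (x \<otimes> long I) ` generate W J = ?B"
    using conjug_image_mult[OF _ _ c(2), of x "long I"] K(4) by simp
  \<comment> \<open>\<open>W_K\<close> is itself the conjugate of \<open>W_I\<close> by
    \<open>long J\<close>, so \<open>long J\<close> acts twice and cancels; \<open>long I\<close>
    normalises \<open>W_I\<close>.\<close>
  have "conjug (x \<otimes> long I \<otimes> long J) ` generate W K =
      conjug x ` conjug (long I) ` conjug (long J) ` conjug (long J) ` generate W I"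
    using c(1) by (simp add: K(3) conjug_image_mult conjug_image_closed)
  then have A3: "conjug (x \<otimes> long I \<otimes> long J) ` generate W K = ?A"
    using conjug_long_long[OF J c(1)] conjug_long_generate[OF I connD(1)[OF I]] by simp
  have "x \<otimes> long I \<otimes> long J \<otimes> long K = x \<otimes> long J"
    using K(1) prod by (simp add: m_assoc)
  then have B4: "conjug (x \<otimes> long I \<otimes> long J \<otimes> long K) ` generate W J = ?B"
    using conjug_image_mult[OF _ _ c(2), of x "long J"]
      conjug_long_generate[OF J connD(1)[OF J]] by simp
  have par: "parabs x [I, J, K, J] = [?A, ?B, ?A, ?B]" using B2 A3 B4 by simp
  have P: "?A \<in> conj_parabolics W S" "?B \<in> conj_parabolics W S"
    unfolding conj_parabolics_eq using x I J by blast+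
  show "pres_eq (RACG_relators W S) (letters (parabs x [I, J, K, J])) []"
  \<comment> \<open>For \<open>?A = ?B\<close> the image is a fourth power, which the square relator
    kills; otherwise it is a commutation relator.\<close>
  proof (cases "?A = ?B")
    case True
    have sq: "letters [?A, ?A] \<in> RACG_relators W S"
      using P by (auto simp: RACG_relators_def letters_def)
    then have "pres_eq (RACG_relators W S) (letters [?A, ?A] @ letters [?A, ?A]) ([] @ [])"
      using pres_rel[OF sq, of "[]" "[]"] by (intro pres_eq_append) auto
    then show ?thesis unfolding par by (simp add: True letters_def)
  next
    case False
    then have "m_two W ?A ?B" using K(5) m_two_conjug[OF x c(1,2)] by auto
    then have "letters [?A, ?B, ?A, ?B] \<in> RACG_relators W S"
      using P by (auto simp: RACG_relators_def letters_def)
    from pres_rel[OF this, of "[]" "[]"] show ?thesis unfolding par by simp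
  qed
qed


lemma lprod_square: "I \<in> conn \<Longrightarrow> lprod [I, I] = \<one>"
  by simp

lemma conj_longest_conn:
  "I \<in> conn \<Longrightarrow> J \<in> conn \<Longrightarrow> I \<subseteq> J \<or> is_dprod W I J \<Longrightarrow> conj_longest W S J I \<in> conn"
  using cactus_relation(1) by (simp add: is_dprod_iff)

lemma cactus_relators_words: "cactus_relators W S \<subseteq> words conn"
  using conj_longest_conn by (auto simp: cactus_relators_def)

lemma RACG_relators_words: "RACG_relators W S \<subseteq> words (conj_parabolics W S)"
  by (auto simp: RACG_relators_def)

text \<open>The homomorphism from the cactus group to the semidirect product of the right-angled Coxeter
  group and \<open>W\<close>, \<open>\<gamma>\<^sub>I \<mapsto> (\<tau>\<^bsub>W\<^sub>I\<^esub>, w\<^sub>I)\<close>, is encoded on words by the pair \<open>(parabs \<one>, lprod)\<close>.\<close>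

lemma cactus_to_RACG:
  assumes "pres_eq (cactus_relators W S) u v" "u \<in> words conn" "v \<in> words conn"
  shows "lprod (map fst u) = lprod (map fst v) \<and>
    pres_eq (RACG_relators W S) (letters (parabs \<one> (map fst u))) (letters (parabs \<one> (map fst v)))"
proof -
  let ?R = "RACG_relators W S"
  define F where "F w = (lprod (map fst w), {z. pres_eq ?R (letters (parabs \<one> (map fst w))) z})"
    for w :: "'a set word"
  \<comment> \<open>Triviality of the image of \<open>r\<close> is asked at every base point because
    the prefix \<open>u\<close> shifts it. As \<open>lprod\<close> of \<open>r\<close> is trivial,
    the suffix keeps its base point.\<close>
  have step: "F (u @ r @ v) = F (u @ v)"
    if uv: "u \<in> words conn" "v \<in> words conn" "set (map fst r) \<subseteq> conn"
      and r: "lprod (map fst r) = \<one>"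
        "\<And>x. x \<in> carrier W \<Longrightarrow> pres_eq ?R (letters (parabs x (map fst r))) []" for u v r
  proof -
    let ?u = "map fst u" and ?v = "map fst v" and ?r = "map fst r" and ?x = "lprod (map fst u)"
    have c: "set ?u \<subseteq> conn" "set ?v \<subseteq> conn" "set ?r \<subseteq> conn" "set (?r @ ?v) \<subseteq> conn"
      using uv words_subset[OF uv(1)] words_subset[OF uv(2)] by auto
    have x: "?x \<in> carrier W" using c by simp
    have "lprod (?r @ ?v) = lprod ?v" unfolding lprod_append[OF c(3,2)] r(1) using c by simp
    then have prod: "lprod (?u @ ?r @ ?v) = lprod (?u @ ?v)"
      by (simp only: lprod_append[OF c(1,4)] lprod_append[OF c(1,2)])
    have p1: "parabs \<one> (?u @ ?r @ ?v) = parabs \<one> ?u @ parabs ?x ?r @ parabs ?x ?v"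
      using parabs_append[OF one_closed c(1,4)] parabs_append[OF x c(3,2)] r(1) x by simp
    have p2: "parabs \<one> (?u @ ?v) = parabs \<one> ?u @ parabs ?x ?v"
      using parabs_append[OF one_closed c(1,2)] x by simp
    have "pres_eq ?R (letters (parabs \<one> (?u @ ?r @ ?v))) (letters (parabs \<one> (?u @ ?v)))"
      unfolding p1 p2 letters_append
      using pres_eq_context[OF r(2)[OF x], of "letters (parabs \<one> ?u)" "letters (parabs ?x ?v)"] by simp
    then have "{z. pres_eq ?R (letters (parabs \<one> (?u @ ?r @ ?v))) z} =
        {z. pres_eq ?R (letters (parabs \<one> (?u @ ?v))) z}"
      using pres_sym pres_trans by (metis (no_types, lifting))
    then show ?thesis unfolding F_def map_append prod by simp
  qed
  have "F u = F v"
  proof (rule pres_eq_invariant[OF assms(1) cactus_relators_words assms(2,3)])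
    fix u v I b assume uv: "u \<in> words conn" "v \<in> words conn" "I \<in> conn"
    then show "F (u @ [(I, b), (I, \<not> b)] @ v) = F (u @ v)"
      using lprod_square[OF uv(3)] parabs_square[OF _ uv(3)] by (intro step) simp_all
  next
    fix u v r assume uv: "u \<in> words conn" "v \<in> words conn" and r: "r \<in> cactus_relators W S"
    have "set (map fst r) \<subseteq> conn \<and> lprod (map fst r) = \<one> \<and>
        (\<forall>x\<in>carrier W. pres_eq ?R (letters (parabs x (map fst r))) [])"
    proof -
      from r consider I where "I \<in> conn" "map fst r = [I, I]"
        | I J where "I \<in> conn" "J \<in> conn" "I \<subseteq> J \<or> is_dprod W I J"
          "map fst r = [I, J, conj_longest W S J I, J]"
        unfolding cactus_relators_def by fastforce
      then show ?thesis
      proof cases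
        case 1
        then show ?thesis using lprod_square parabs_square by (simp del: parabs.simps lprod_simps)
      next
        case 2
        show ?thesis
          unfolding 2(4)
          using 2(1-3) parabs_relator(1)[OF _ 2(1,2)] parabs_relator(2)[OF one_closed 2(1,2)]
            conj_longest_conn[OF 2(1-3)]
          by (simp add: is_dprod_iff del: parabs.simps lprod_simps)
      qed
    qed
    then show "F (u @ r @ v) = F (u @ v)" using uv by (intro step) auto
  qed
  then have "lprod (map fst u) = lprod (map fst v)"
    "{z. pres_eq ?R (letters (parabs \<one> (map fst u))) z} =
      {z. pres_eq ?R (letters (parabs \<one> (map fst v))) z}"
    by (simp_all add: F_def)
  then show ?thesis using pres_refl by blast
qed

section \<open>Normal forms in the right-angled group and their lift to cactus words\<close>

definition commuting :: "'a set \<Rightarrow> 'a set \<Rightarrow> bool" where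
  "commuting A B \<longleftrightarrow> A \<noteq> B \<and> m_two W A B"

text \<open>Irreflexivity is supplied by the condition \<open>A \<noteq> B\<close> built into
  \<open>commuting\<close>.\<close>

sublocale trace: commutation commuting
  by unfold_locales (auto simp: commuting_def intro: m_two_sym)

text \<open>The trace class of the normal form is invariant under the relators, so for a trivial
  word it is the class of \<open>[]\<close>, which has no other member.\<close>

lemma RACG_trivial_imp_push:
  assumes "pres_eq (RACG_relators W S) (letters l) []" "set l \<subseteq> conj_parabolics W S"
  shows "foldr trace.push l [] = []"
proof -
  let ?nf = "\<lambda>w :: 'a set word. foldr trace.push (map fst w) []"
  have class_eq: "{z. trace.trace_eq x z} = {z. trace.trace_eq y z}" if "trace.trace_eq x y" for x y
    using that trace.trace_sym trace.trace_trans by (metis (no_types, lifting))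
  have "{z. trace.trace_eq (?nf (letters l)) z} = {z. trace.trace_eq (?nf []) z}"
  proof (rule pres_eq_invariant[OF assms(1) RACG_relators_words, where F = "\<lambda>w. {z. trace.trace_eq (?nf w) z}"])
    fix u v :: "'a set word" and A b
    show "{z. trace.trace_eq (?nf (u @ [(A, b), (A, \<not> b)] @ v)) z} = {z. trace.trace_eq (?nf (u @ v)) z}"
      by (rule class_eq) (use trace.foldr_push_relator[of "[A, A]" A A "map fst u" "map fst v"] in simp)
  next
    fix u v r assume "r \<in> RACG_relators W S"
    then obtain A B where "map fst r = [A, A] \<or> map fst r = [A, B, A, B] \<and> (commuting A B \<or> A = B)"
      unfolding RACG_relators_def commuting_def by fastforce
    from trace.foldr_push_relator[OF this]
    show "{z. trace.trace_eq (?nf (u @ r @ v)) z} = {z. trace.trace_eq (?nf (u @ v)) z}"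
      by (intro class_eq) simp
  qed (use letters_words[OF assms(2)] in simp_all)
  then have "trace.trace_eq (foldr trace.push l []) []" using trace.trace_refl by auto
  then show ?thesis using trace.trace_eq_length by fastforce
qed

lemma conn_generate_subset_iff:
  "I \<in> conn \<Longrightarrow> J \<in> conn \<Longrightarrow> generate W I \<subseteq> generate W J \<longleftrightarrow> I \<subseteq> J"
  using generate_subset_iff connD(1) by blast

text \<open>The two subgroups in the hypothesis are the image letters of \<open>[I, J]\<close>.
  Their commutation lifts to a cactus relation after which the former second image letter stands
  first.\<close>

lemma cactus_swap:
  assumes I: "I \<in> conn" and J: "J \<in> conn"
    and m: "m_two W (generate W I) (conjug (long I) ` generate W J)"
  shows "\<exists>I' J'. I' \<in> conn \<and> J' \<in> conn \<and>
    generate W J' = conjug (long I) ` generate W J \<and>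
    pres_eq (cactus_relators W S) (letters [I, J]) (letters [J', I'])"
proof -
  note c = conn_generate_carrier[OF I] conn_generate_carrier[OF J]
  note lc = long_closed[OF I]
  have I_fix: "conjug (long I) ` generate W I = generate W I"
    using conjug_long_generate[OF I connD(1)[OF I]] by simp
  have "m_two W (conjug (long I) ` generate W I) (conjug (long I) ` generate W J)"
    using m by (simp only: I_fix)
  then have "m_two W (generate W I) (generate W J)"
    using m_two_conjug_iff[OF lc c] by blast
  then consider "generate W I \<subset> generate W J \<or> indep (generate W I) (generate W J)"
    | "generate W J \<subset> generate W I"
    by (auto simp: m_two_iff)
  then show ?thesis
  proof cases
    \<comment> \<open>The relation for \<open>I, J\<close> is read from left to right with
      \<open>J' = J\<close>, since here \<open>long I\<close> normalises \<open>W_J\<close>.\<close>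
    case 1
    then have IJ: "I \<subseteq> J \<or> indep (generate W I) (generate W J)"
      using conn_generate_subset_iff[OF I J] by auto
    note K = cactus_relation[OF I J IJ]
    show ?thesis
      using pres_eq_cactus_swap[OF I J] IJ K(1,4) J
      by (intro exI[of _ "conj_longest W S J I"] exI[of _ J]) (simp add: is_dprod_iff)
  next
    \<comment> \<open>The relation for \<open>?K, I\<close> is read from right to left with
      \<open>J' = ?K\<close>: conjugating \<open>?K\<close> by \<open>long I\<close> gives back
      \<open>J\<close>.\<close>
    case 2
    then have JI: "J \<subseteq> I" using conn_generate_subset_iff[OF J I] by auto
    let ?K = "conj_longest W S I J"
    have K: "?K \<in> conn" "generate W ?K = conjug (long I) ` generate W J"
      using cactus_relation(1,3)[OF J I] JI by auto
    have "J \<subseteq> carrier W" using connD(1)[OF J] S_carrier by blast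
    then have KK: "conj_longest W S I ?K = J"
      using conjug_long_long[OF I] by (simp add: conj_longest_eq[OF I])
    have "generate W ?K \<subseteq> generate W I"
      using image_mono[of "generate W J" "generate W I" "conjug (long I)"] 2 I_fix K(2) by auto
    then have "?K \<subseteq> I" using conn_generate_subset_iff[OF K(1) I] by blast
    then have "pres_eq (cactus_relators W S) (letters [I, J]) (letters [?K, I])"
      using pres_eq_cactus_swap[OF K(1) I] pres_sym unfolding KK by blast
    then show ?thesis using K I by blast
  qed
qed

text \<open>A successful \<open>pull\<close> is a chain of commutations, each realised by
  \<open>cactus_swap\<close>. Labels may change on the way, but the conjugate \<open>A\<close> and
  the length do not.\<close>

lemma cactus_pull:
  assumes "trace.pull A (parabs u w) = Some z" "set w \<subseteq> conn" "u \<in> carrier W"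
  shows "\<exists>J v. J \<in> conn \<and> set v \<subseteq> conn \<and> length w = Suc (length v) \<and>
    conjug u ` generate W J = A \<and>
    pres_eq (cactus_relators W S) (letters w) (letters (J # v))"
  using assms
proof (induction w arbitrary: u z)
  case (Cons I w)
  have I: "I \<in> conn" and w: "set w \<subseteq> conn" using Cons.prems by auto
  let ?R = "cactus_relators W S"
  show ?case
  proof (cases "A = conjug u ` generate W I")
    case True
    then show ?thesis using I w pres_refl[of ?R] by (intro exI[of _ I] exI[of _ w]) auto
  next
    case False
    then obtain z' where z': "commuting A (conjug u ` generate W I)"
      "trace.pull A (parabs (u \<otimes> long I) w) = Some z'"
      using Cons.prems(1) by (auto split: if_splits)
    have "u \<otimes> long I \<in> carrier W" using Cons.prems I by simp
    from Cons.IH[OF z'(2) w this] obtain J v where J: "J \<in> conn" and v: "set v \<subseteq> conn"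
      "length w = Suc (length v)" and A: "conjug (u \<otimes> long I) ` generate W J = A"
      and eq: "pres_eq ?R (letters w) (letters (J # v))"
      by blast
    let ?B = "conjug (long I) ` generate W J"
    have c: "generate W I \<subseteq> carrier W" "generate W J \<subseteq> carrier W" "?B \<subseteq> carrier W"
      using conn_generate_carrier I J conjug_image_closed by simp_all
    have A': "A = conjug u ` ?B"
      using A conjug_image_mult[OF _ _ c(2), of u "long I"] Cons.prems I by simp
    have "m_two W (conjug u ` generate W I) (conjug u ` ?B)"
      using z'(1) m_two_sym unfolding commuting_def A' by blast
    then have "m_two W (generate W I) ?B"
      using m_two_conjug_iff[OF _ c(1,3), of u] Cons.prems by simp
    from cactus_swap[OF I J this] obtain I' J' where I': "I' \<in> conn" "J' \<in> conn"
      "generate W J' = ?B" "pres_eq ?R (letters [I, J]) (letters [J', I'])"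
      by blast
    have "pres_eq ?R (letters [I] @ letters w) (letters [I] @ letters (J # v))"
      by (intro pres_eq_append eq pres_refl)
    moreover have "pres_eq ?R (letters [I, J] @ letters v) (letters [J', I'] @ letters v)"
      by (intro pres_eq_append I' pres_refl)
    ultimately have "pres_eq ?R (letters (I # w)) (letters (J' # I' # v))"
      unfolding letters_append[symmetric] append_Cons append_Nil by (rule pres_trans)
    then show ?thesis
      using I' v A' by (intro exI[of _ J'] exI[of _ "I' # v"]) auto
  qed
qed simp

text \<open>A cancelling pair in the image lifts to one in the cactus word, which loses two letters.
  By \<open>cactus_to_RACG\<close> the shorter word again has trivial image, so the induction
  applies.\<close>

lemma RACG_trivial_imp_cactus_trivial:
  assumes "set w \<subseteq> conn" "pres_eq (RACG_relators W S) (letters (parabs \<one> w)) []"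
  shows "pres_eq (cactus_relators W S) (letters w) []"
  using assms
proof (induction "length w" arbitrary: w rule: less_induct)
  case less
  let ?R = "cactus_relators W S"
  show ?case
  proof (cases "w = []")
    case True
    then show ?thesis by (simp add: letters_def pres_refl)
  next
    case False
    have "foldr trace.push (parabs \<one> w) [] = []"
      using RACG_trivial_imp_push less.prems set_parabs by simp
    moreover have "parabs \<one> w \<noteq> []" using False by (cases w) auto
    ultimately obtain p A q z where pq: "parabs \<one> w = p @ A # q" "trace.pull A q = Some z"
      by (rule trace.foldr_push_Nil_imp_pull)
    \<comment> \<open>This locates the cactus letter behind the entry \<open>A\<close>; the base
      point is left general for the induction.\<close>
    have split: "\<exists>x I y. w = x @ I # y \<and> A = conjug (u \<otimes> lprod x) ` generate W I \<and>
        q = parabs (u \<otimes> lprod x \<otimes> long I) y"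
      if "parabs u w = p @ A # q" "set w \<subseteq> conn" "u \<in> carrier W" for u w
      using that
    proof (induction w arbitrary: u p)
      case (Cons I w)
      show ?case
      proof (cases p)
        case Nil
        then show ?thesis using Cons.prems by (intro exI[of _ "[]"] exI[of _ I] exI[of _ w]) auto
      next
        case (Cons B p')
        then obtain x K y where xy: "w = x @ K # y" "A = conjug (u \<otimes> long I \<otimes> lprod x) ` generate W K"
          "q = parabs (u \<otimes> long I \<otimes> lprod x \<otimes> long K) y"
          using Cons.IH[of "u \<otimes> long I" p'] Cons.prems by auto
        then show ?thesis using Cons.prems
          by (intro exI[of _ "I # x"] exI[of _ K] exI[of _ y]) (auto simp: m_assoc)
      qed
    qed simp
    from split[OF pq(1) less.prems(1) one_closed] obtain x I y where w: "w = x @ I # y"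
      and A: "A = conjug (lprod x) ` generate W I" and q: "q = parabs (lprod x \<otimes> long I) y"
      using less.prems(1) by fastforce
    have c: "set x \<subseteq> conn" "I \<in> conn" "set y \<subseteq> conn" using less.prems(1) w by auto
    let ?u = "lprod x \<otimes> long I"
    have u: "?u \<in> carrier W" using c by simp
    obtain J v where J: "J \<in> conn" "set v \<subseteq> conn" "length y = Suc (length v)"
      "conjug ?u ` generate W J = A" "pres_eq ?R (letters y) (letters (J # v))"
      using cactus_pull[OF pq(2)[unfolded q] c(3) u] by blast
    note gc = conn_generate_carrier[OF c(2)] conn_generate_carrier[OF J(1)]
    \<comment> \<open>As \<open>long I\<close> normalises \<open>W_I\<close>, the base point after
      reading \<open>I\<close> also carries \<open>W_I\<close> to \<open>A\<close>. Comparison with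
      the pulled letter gives \<open>I = J\<close>.\<close>
    have "conjug ?u ` generate W I = A"
      using conjug_image_mult[OF lprod_closed[OF c(1)] long_closed[OF c(2)] gc(1)]
        conjug_long_generate[OF c(2) connD(1)[OF c(2)]] A by simp
    then have "generate W I = generate W J"
      using conjug_image_eq_iff[OF u gc] J(4) by simp
    then have "I = J" using conn_generate_subset_iff c(2) J(1) by blast
    then have "pres_eq ?R (letters y) (letters (I # v))" using J(5) by simp
    then have "pres_eq ?R (letters [I] @ letters y) (letters [I] @ letters (I # v))"
      by (rule pres_eq_append[OF pres_refl])
    then have "pres_eq ?R (letters x @ letters [I] @ letters y) (letters x @ letters [I] @ letters (I # v))"
      by (rule pres_eq_append[OF pres_refl])
    moreover have "pres_eq ?R (letters x @ letters [I, I] @ letters v) (letters x @ letters v)"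
      by (rule pres_eq_cactus_square[OF c(2)])
    ultimately have eq: "pres_eq ?R (letters w) (letters (x @ v))"
      unfolding w letters_append[symmetric] append_Cons append_Nil by (rule pres_trans)
    have xv: "set (x @ v) \<subseteq> conn" using c J by simp
    have "pres_eq (RACG_relators W S) (letters (parabs \<one> w)) (letters (parabs \<one> (x @ v)))"
      using cactus_to_RACG[OF eq letters_words[OF less.prems(1)] letters_words[OF xv]] by simp
    then have "pres_eq (RACG_relators W S) (letters (parabs \<one> (x @ v))) []"
      using less.prems(2) pres_sym pres_trans by blast
    then have "pres_eq ?R (letters (x @ v)) []"
      using less.hyps[of "x @ v"] xv J(3) w by simp
    then show ?thesis using eq pres_trans by blast
  qed
qed

end

section \<open>The embedding of the pure cactus group\<close>

theorem theorem1:
  fixes W :: "('a, 'b) monoid_scheme" and S :: "'a set"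
  assumes "coxeter_system W S" and "finite S"
  shows "\<exists>h. h \<in> hom (pure_cactus_group W S) (RACG W S) \<and>
             inj_on h (carrier (pure_cactus_group W S))"
proof -
  interpret coxeter W S
    using assms(1) by (intro coxeter.intro coxeter_axioms.intro) (simp_all add: coxeter_system_def)
  let ?R = "cactus_relators W S" and ?Q = "RACG_relators W S" and ?P = "conj_parabolics W S"
  define rep where "rep A = (SOME w :: 'a set word. w \<in> A)" for A
  define \<phi> where "\<phi> w = letters (parabs \<one>\<^bsub>W\<^esub> (map fst w))" for w :: "'a set word"
  define h where "h A = pres_class ?P ?Q (\<phi> (rep A))" for A
  have \<phi>_words: "\<phi> w \<in> words ?P" if "w \<in> words conn" for w
    unfolding \<phi>_def by (rule letters_words[OF set_parabs[OF one_closed words_subset[OF that]]])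
  have \<phi>_cong: "pres_eq ?Q (\<phi> u) (\<phi> v)"
    if "pres_eq ?R u v" "u \<in> words conn" "v \<in> words conn" for u v
    using cactus_to_RACG[OF that] by (simp add: \<phi>_def)
  \<comment> \<open>Purity enters here: a left factor with trivial product leaves the base point at
    \<open>\<one>\<close>, so the twist of the semidirect product disappears.\<close>
  have \<phi>_append: "\<phi> (u @ v) = \<phi> u @ \<phi> v"
    if "u \<in> words conn" "v \<in> words conn" "lprod (map fst u) = \<one>\<^bsub>W\<^esub>" for u v
    using parabs_append[OF one_closed words_subset[OF that(1)] words_subset[OF that(2)]] that(3)
    by (simp add: \<phi>_def letters_append)
  have pureD: "rep A \<in> words conn" "A = pres_class conn ?R (rep A)" "lprod (map fst (rep A)) = \<one>\<^bsub>W\<^esub>"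
    if A: "A \<in> carrier (pure_cactus_group W S)" for A
  proof -
    obtain u where u: "u \<in> words conn" "A = pres_class conn ?R u"
      using A by (auto simp: pure_cactus_group_def cactus_group_def carrier_pres_group)
    show rep: "rep A \<in> words conn"
      using some_in_pres_class(1)[OF u] by (simp add: rep_def)
    have "pres_eq ?R (rep A) u"
      using some_in_pres_class(2)[OF u] by (simp add: rep_def)
    then show "A = pres_class conn ?R (rep A)"
      using pres_class_eq_iff[OF rep u(1)] unfolding u(2) by blast
    show "lprod (map fst (rep A)) = \<one>\<^bsub>W\<^esub>"
      using A eval_word_long[OF rep]
      by (simp add: pure_cactus_group_def cactus_hom_def pres_hom_def rep_def)
  qed
  have "h \<in> hom (pure_cactus_group W S) (RACG W S)"
  proof (rule homI)
    fix A assume "A \<in> carrier (pure_cactus_group W S)"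
    then show "h A \<in> carrier (RACG W S)"
      using pureD(1) \<phi>_words by (simp add: h_def RACG_def carrier_pres_group)
  next
    fix A B assume A: "A \<in> carrier (pure_cactus_group W S)" and B: "B \<in> carrier (pure_cactus_group W S)"
    let ?x = "rep A" and ?y = "rep B" and ?Z = "A \<otimes>\<^bsub>pure_cactus_group W S\<^esub> B"
    note wx = pureD(1)[OF A] and wy = pureD(1)[OF B]
    have xy: "?x @ ?y \<in> words conn" using wx wy by simp
    have "?Z = pres_class conn ?R ?x \<otimes>\<^bsub>pres_group conn ?R\<^esub> pres_class conn ?R ?y"
      using pureD(2)[OF A] pureD(2)[OF B] by (simp add: pure_cactus_group_def cactus_group_def)
    then have Z: "?Z = pres_class conn ?R (?x @ ?y)"
      by (simp only: mult_pres_class[OF wx wy])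
    note z = some_in_pres_class[OF xy Z, folded rep_def]
    have "pres_eq ?Q (\<phi> (rep ?Z)) (\<phi> ?x @ \<phi> ?y)"
      using \<phi>_cong[OF z(2,1) xy] \<phi>_append[OF wx wy pureD(3)[OF A]] by simp
    then have "h ?Z = pres_class ?P ?Q (\<phi> ?x @ \<phi> ?y)"
      unfolding h_def using \<phi>_words[OF z(1)] \<phi>_words[OF wx] \<phi>_words[OF wy]
      by (subst pres_class_eq_iff) simp_all
    then show "h ?Z = h A \<otimes>\<^bsub>RACG W S\<^esub> h B"
      unfolding h_def RACG_def by (simp only: mult_pres_class[OF \<phi>_words[OF wx] \<phi>_words[OF wy]])
  qed
  moreover have "inj_on h (carrier (pure_cactus_group W S))"
  proof (rule inj_onI)
    fix A B assume A: "A \<in> carrier (pure_cactus_group W S)" and B: "B \<in> carrier (pure_cactus_group W S)"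
      and eq: "h A = h B"
    let ?x = "rep A" and ?y = "rep B"
    note wx = pureD(1)[OF A] and wy = pureD(1)[OF B]
    note iy = inv_word_in_words[OF wy]
    have "pres_eq ?Q (\<phi> ?x) (\<phi> ?y)"
      using eq pres_class_eq_iff[OF \<phi>_words[OF wx] \<phi>_words[OF wy]] by (simp add: h_def)
    then have "pres_eq ?Q (\<phi> ?x @ \<phi> (inv_word ?y)) (\<phi> ?y @ \<phi> (inv_word ?y))"
      by (rule pres_eq_append) (rule pres_refl)
    \<comment> \<open>Both left factors \<open>?x\<close> and \<open>?y\<close> are pure, so
      \<open>\<phi>_append\<close> applies to either concatenation.\<close>
    then have "pres_eq ?Q (\<phi> (?x @ inv_word ?y)) (\<phi> (?y @ inv_word ?y))"
      using \<phi>_append[OF wx iy pureD(3)[OF A]] \<phi>_append[OF wy iy pureD(3)[OF B]] by simp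
    moreover have "pres_eq ?Q (\<phi> (?y @ inv_word ?y)) (\<phi> [])"
      using wy iy by (intro \<phi>_cong pres_eq_inv_word) simp_all
    ultimately have triv: "pres_eq ?Q (\<phi> (?x @ inv_word ?y)) []"
      using pres_trans by (fastforce simp: \<phi>_def letters_def)
    have w: "?x @ inv_word ?y \<in> words conn" using wx iy by simp
    have "pres_eq ?R (letters (map fst (?x @ inv_word ?y))) []"
      using RACG_trivial_imp_cactus_trivial[OF words_subset[OF w]] triv by (simp add: \<phi>_def)
    then have "pres_eq ?R (?x @ inv_word ?y) []"
      using pres_eq_letters[OF w] pres_trans by blast
    then have "pres_eq ?R ?x ?y" by (rule pres_eq_cancel_right)
    then have "pres_class conn ?R ?x = pres_class conn ?R ?y"
      by (simp only: pres_class_eq_iff[OF wx wy])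
    then show "A = B" by (simp only: pureD(2)[OF A, symmetric] pureD(2)[OF B, symmetric])
  qed
  ultimately show ?thesis by blast
qed

end
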